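(* Let $G$ be a finite group, let $S$ be an inverse-closed subset of $G$ with $1\notin S$ that is a union of conjugacy classes of $G$, and suppose the Cayley graph $\Gamma=\mathrm{Cay}(G,S)$ is connected. Let $\alpha,\beta$ be nonzero complex numbers, let $u,v\in G$ be distinct, and let $t\in\mathbb{R}$. Then $(\alpha,\beta)$-revival occurs on $\Gamma$ from $u$ to $v$ at time $t$ if and only if the following two statements hold: (a) $\chi(uv^{-1})=\pm d_\chi$ for all $\chi\in\widehat{G}$, or equivalently, $|G|$ is even and $uv^{-1}$ is an element of order two that lies in the center of $G$; (b) $\exp(\mathrm{i}t\lambda_\chi)=\alpha+\beta$ for all $\chi\in\widehat{G}_0$ and $\exp(\mathrm{i}t\lambda_\chi)=\alpha-\beta$ for all $\chi\in\widehat{G}_1$, where $\widehat{G}_0=\{\chi\in\widehat{G}\mid \chi(uv^{-1})=d_\chi\}$ and $\widehat{G}_1=\{\chi\in\widehat{G}\mid\chi(uv^{-1})=-d_\chi\}$. In particular, if such fractional revival occurs, then $\Gamma$ is an integral graph, i.e., $\lambda_\chi\in\mathbb{Z}$ for all $\chi\in\widehat{G}$.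
   Context: $\mathrm{Cay}(G,S)$ is the graph with vertex set $G$ and edges $\{g,sg\}$ for $g\in G$, $s\in S$; it is called quasi-abelian when $S$ is a union of conjugacy classes of $G$. Let $A$ be its adjacency matrix and $H(t)=\exp(\mathrm{i}tA)$ its transition matrix, and let $\mathbf{e}_w$ denote the standard basis vector indexed by vertex $w$. For distinct vertices $u,v$, $(\alpha,\beta)$-revival occurs from $u$ to $v$ at time $t$ if $H(t)\mathbf{e}_u=\alpha\mathbf{e}_u+\beta\mathbf{e}_v$ with $\alpha,\beta\in\mathbb{C}$, $\beta\ne 0$, $|\alpha|^2+|\beta|^2=1$. $\widehat{G}$ is the set of irreducible complex characters of $G$, $d_\chi=\chi(1)$, and for $\chi\in\widehat{G}$, $\lambda_\chi=\frac{1}{d_\chi}\sum_{g\in S}\chi(g)$ (these are the eigenvalues of $A$, $\lambda_\chi$ with multiplicity $d_\chi^2$). *)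

theory Defs
  imports
    "HOL-Algebra.Multiplicative_Group"
    "Jordan_Normal_Form.VS_Connect"
    "Graph_Theory.Graph_Theory"
begin

definition conjugacy_class :: "('a, 'b) monoid_scheme \<Rightarrow> 'a \<Rightarrow> 'a set" where
  "conjugacy_class G x = {g \<otimes>\<^bsub>G\<^esub> x \<otimes>\<^bsub>G\<^esub> inv\<^bsub>G\<^esub> g | g. g \<in> carrier G}"

definition union_of_conjugacy_classes :: "('a, 'b) monoid_scheme \<Rightarrow> 'a set \<Rightarrow> bool" where
  "union_of_conjugacy_classes G S \<longleftrightarrow> (\<exists>X \<subseteq> carrier G. S = (\<Union>x\<in>X. conjugacy_class G x))"

definition center :: "('a, 'b) monoid_scheme \<Rightarrow> 'a set" where
  "center G = {z \<in> carrier G. \<forall>g \<in> carrier G. z \<otimes>\<^bsub>G\<^esub> g = g \<otimes>\<^bsub>G\<^esub> z}"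

abbreviation general_linear :: "nat \<Rightarrow> complex mat monoid" where
  "general_linear n \<equiv> units_of (ring_mat TYPE(complex) n ())"

definition irreducible_rep ::
    "('a, 'b) monoid_scheme \<Rightarrow> nat \<Rightarrow> ('a \<Rightarrow> complex mat) \<Rightarrow> bool" where
  "irreducible_rep G n \<rho> \<longleftrightarrow>
     \<rho> \<in> hom G (general_linear n) \<and> n > 0 \<and>
     (\<forall>W. VectorSpace.subspace class_ring W (module_vec TYPE(complex) n) \<and>
          (\<forall>g \<in> carrier G. \<forall>w \<in> W. \<rho> g *\<^sub>v w \<in> W)
        \<longrightarrow> W = {0\<^sub>v n} \<or> W = carrier_vec n)"

text \<open>Characters are made extensional (\<^const>\<open>undefined\<close> off the carrier), so that distinct
  elements of \<open>irr_characters G\<close> are distinct as functions on the group.\<close>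

definition irr_characters :: "('a, 'b) monoid_scheme \<Rightarrow> ('a \<Rightarrow> complex) set" where
  "irr_characters G =
     {(\<lambda>g \<in> carrier G. \<Sum>i<n. \<rho> g $$ (i, i)) | n \<rho>. irreducible_rep G n \<rho>}"

definition char_degree :: "('a, 'b) monoid_scheme \<Rightarrow> ('a \<Rightarrow> complex) \<Rightarrow> complex" where
  "char_degree G \<chi> = \<chi> \<one>\<^bsub>G\<^esub>"

definition cayley_eigenvalue ::
    "('a, 'b) monoid_scheme \<Rightarrow> 'a set \<Rightarrow> ('a \<Rightarrow> complex) \<Rightarrow> complex" where
  "cayley_eigenvalue G S \<chi> = 1 / char_degree G \<chi> * (\<Sum>g\<in>S. \<chi> g)"

text \<open>A square matrix with rows and columns indexed by a finite set \<open>V\<close> is a function of two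
  arguments, of which only the values on \<open>V\<close> matter; likewise for vectors.\<close>

definition mat_mult_on ::
    "'a set \<Rightarrow> ('a \<Rightarrow> 'a \<Rightarrow> complex) \<Rightarrow> ('a \<Rightarrow> 'a \<Rightarrow> complex) \<Rightarrow> 'a \<Rightarrow> 'a \<Rightarrow> complex" where
  "mat_mult_on V M N = (\<lambda>x y. \<Sum>z\<in>V. M x z * N z y)"

definition mat_vec_on ::
    "'a set \<Rightarrow> ('a \<Rightarrow> 'a \<Rightarrow> complex) \<Rightarrow> ('a \<Rightarrow> complex) \<Rightarrow> 'a \<Rightarrow> complex" where
  "mat_vec_on V M f = (\<lambda>x. \<Sum>z\<in>V. M x z * f z)"

primrec mat_pow_on ::
    "'a set \<Rightarrow> ('a \<Rightarrow> 'a \<Rightarrow> complex) \<Rightarrow> nat \<Rightarrow> 'a \<Rightarrow> 'a \<Rightarrow> complex" where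
  "mat_pow_on V M 0 = (\<lambda>x y. if x = y then 1 else 0)"
| "mat_pow_on V M (Suc k) = mat_mult_on V M (mat_pow_on V M k)"

definition mat_exp_on ::
    "'a set \<Rightarrow> ('a \<Rightarrow> 'a \<Rightarrow> complex) \<Rightarrow> 'a \<Rightarrow> 'a \<Rightarrow> complex" where
  "mat_exp_on V M = (\<lambda>x y. \<Sum>k. mat_pow_on V M k x y / fact k)"

definition unit_vec_at :: "'a \<Rightarrow> 'a \<Rightarrow> complex" where
  "unit_vec_at w = (\<lambda>x. if x = w then 1 else 0)"

text \<open>Following the convention of the graph library, an undirected edge \<open>{x, y}\<close> is the pair
  of arcs \<open>(x, y)\<close>, \<open>(y, x)\<close>.\<close>

definition cayley_graph :: "('a, 'b) monoid_scheme \<Rightarrow> 'a set \<Rightarrow> 'a pair_pre_digraph" where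
  "cayley_graph G S =
     \<lparr> pverts = carrier G,
       parcs = {(x, y). \<exists>g \<in> carrier G. \<exists>s \<in> S. {x, y} = {g, s \<otimes>\<^bsub>G\<^esub> g}} \<rparr>"

definition adjacency_matrix :: "'a pair_pre_digraph \<Rightarrow> 'a \<Rightarrow> 'a \<Rightarrow> complex" where
  "adjacency_matrix \<Gamma> = (\<lambda>x y. if (x, y) \<in> parcs \<Gamma> then 1 else 0)"

definition transition_matrix :: "'a pair_pre_digraph \<Rightarrow> real \<Rightarrow> 'a \<Rightarrow> 'a \<Rightarrow> complex" where
  "transition_matrix \<Gamma> t =
     mat_exp_on (pverts \<Gamma>) (\<lambda>x y. \<i> * complex_of_real t * adjacency_matrix \<Gamma> x y)"

definition revival ::
    "'a pair_pre_digraph \<Rightarrow> complex \<Rightarrow> complex \<Rightarrow> 'a \<Rightarrow> 'a \<Rightarrow> real \<Rightarrow> bool" where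
  "revival \<Gamma> \<alpha> \<beta> u v t \<longleftrightarrow>
     u \<in> pverts \<Gamma> \<and> v \<in> pverts \<Gamma> \<and> u \<noteq> v \<and>
     (\<forall>x \<in> pverts \<Gamma>. mat_vec_on (pverts \<Gamma>) (transition_matrix \<Gamma> t) (unit_vec_at u) x
                      = \<alpha> * unit_vec_at u x + \<beta> * unit_vec_at v x) \<and>
     \<beta> \<noteq> 0 \<and> (cmod \<alpha>)\<^sup>2 + (cmod \<beta>)\<^sup>2 = 1"

definition graph_eigenvalue :: "'a pair_pre_digraph \<Rightarrow> complex \<Rightarrow> bool" where
  "graph_eigenvalue \<Gamma> \<mu> \<longleftrightarrow>
     (\<exists>f. (\<exists>x \<in> pverts \<Gamma>. f x \<noteq> 0) \<and>
          (\<forall>x \<in> pverts \<Gamma>. mat_vec_on (pverts \<Gamma>) (adjacency_matrix \<Gamma>) f x = \<mu> * f x))"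

definition integral_graph :: "'a pair_pre_digraph \<Rightarrow> bool" where
  "integral_graph \<Gamma> \<longleftrightarrow> (\<forall>\<mu>. graph_eigenvalue \<Gamma> \<mu> \<longrightarrow> \<mu> \<in> \<int>)"

end

theory Submission
  imports Defs "Jordan_Normal_Form.Spectral_Radius"
begin

text \<open>
  Write \<open>z = u v\<^sup>-\<^sup>1\<close> and let \<open>A\<close> act on functions by \<open>(A f)(x) = \<Sum>\<^sub>s f (s x)\<close>. By Schur's lemma every
  coefficient \<open>x \<mapsto> c \<bullet> \<rho>(x) w\<close> of an irreducible representation is an eigenfunction of \<open>A\<close> with
  eigenvalue \<open>\<lambda>\<^sub>\<chi>\<close>, and of the translation by any central element. Conversely, a nonzero space of
  functions invariant under right translations contains the coefficients of some irreducible
  representation; applied to an orthogonal complement this shows that the coefficients span all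
  functions, and applied to a joint eigenspace it shows that every joint eigenvalue comes from a
  character.

  The matrix \<open>H(t)\<close> is invariant under left and right translations and under inversion, so a column
  supported on \<open>{u, v}\<close> forces \<open>z\<close> to be a central involution. Comparing \<open>H(t)\<close> with \<open>\<alpha> + \<beta> z\<close> on the
  coefficients gives condition (b) and its converse.

  For integrality, (b) puts all \<open>\<lambda>\<^sub>\<chi>\<close> with the same sign \<open>\<epsilon>\<close> of \<open>z\<close> in one coset of \<open>(2 \<pi> / t) \<int>\<close>. Taking
  the trace of \<open>(A - \<lambda>) (1 + \<epsilon> z)\<close>, with \<open>\<lambda>\<close> one of these eigenvalues, gives an integer multiple of
  \<open>4 \<pi> / t\<close>. For \<open>\<epsilon> = 1\<close> and \<open>\<lambda> = |S|\<close> this makes \<open>4 \<pi> / t\<close> rational unless \<open>S\<close> is empty or \<open>{z}\<close>, and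
  then every \<open>\<lambda>\<^sub>\<chi>\<close> is a rational algebraic integer.
\<close>

subsection \<open>Complex matrices\<close>

definition mat_trace :: "complex mat \<Rightarrow> complex" where
  "mat_trace A = (\<Sum>i<dim_row A. A $$ (i, i))"

lemma mat_mult_index_sum:
  assumes "A \<in> carrier_mat n m" "B \<in> carrier_mat m k" "i < n" "j < k"
  shows "(A * B) $$ (i, j) = (\<Sum>l<m. A $$ (i, l) * B $$ (l, j))"
  using assms by (auto simp: scalar_prod_def lessThan_atLeast0 intro!: sum.cong)

lemma mat_trace_comm:
  assumes "A \<in> carrier_mat n m" "B \<in> carrier_mat m n"
  shows "mat_trace (A * B) = mat_trace (B * A)"
proof -
  have "mat_trace (A * B) = (\<Sum>i<n. \<Sum>l<m. A $$ (i, l) * B $$ (l, i))"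
    using assms
    by (auto simp: mat_trace_def mat_mult_index_sum[of A n m B n] simp del: index_mult_mat(1))
  also have "\<dots> = (\<Sum>l<m. \<Sum>i<n. B $$ (l, i) * A $$ (i, l))"
    by (subst sum.swap) (simp add: mult.commute)
  also have "\<dots> = mat_trace (B * A)"
    using assms
    by (auto simp: mat_trace_def mat_mult_index_sum[of B m n A m] simp del: index_mult_mat(1))
  finally show ?thesis .
qed

lemma mat_trace_similar:
  assumes A: "A \<in> carrier_mat n n" and sim: "similar_mat_wit A B P Q"
  shows "mat_trace A = mat_trace B"
proof -
  from similar_mat_witD2[OF A sim]
  have *: "Q * P = 1\<^sub>m n" "A = P * B * Q" "B \<in> carrier_mat n n" "P \<in> carrier_mat n n" "Q \<in> carrier_mat n n"
    by auto
  have "mat_trace A = mat_trace (Q * (P * B))"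
    unfolding *(2) using * by (intro mat_trace_comm[of _ n n]) auto
  also have "Q * (P * B) = B"
    using * by (simp flip: assoc_mult_mat[of Q n n P n B n])
  finally show ?thesis .
qed

text \<open>The characteristic polynomial splits over the complex numbers, as the Schur
  decomposition requires. The diagonal of the triangular form then lists its roots.\<close>

lemma complex_schur_form:
  fixes A :: "complex mat"
  assumes A: "A \<in> carrier_mat n n"
  obtains B P Q where "similar_mat_wit A B P Q" "upper_triangular B" "B \<in> carrier_mat n n"
    "\<And>i. i < n \<Longrightarrow> eigenvalue A (B $$ (i, i))"
proof -
  from char_poly_factorized[OF A] obtain es where es: "char_poly A = (\<Prod>a\<leftarrow>es. [:- a, 1:])"
    by auto
  obtain B P Q where dec: "schur_decomposition A es = (B, P, Q)"
    by (cases "schur_decomposition A es") auto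
  from schur_decomposition[OF A es dec]
  have sim: "similar_mat_wit A B P Q" and ut: "upper_triangular B" and diag: "diag_mat B = es" by auto
  have B: "B \<in> carrier_mat n n" using similar_mat_witD2[OF A sim] by auto
  have "eigenvalue A (B $$ (i, i))" if "i < n" for i
  proof -
    have "B $$ (i, i) \<in> set es" using that B by (auto simp: diag[symmetric] diag_mat_def)
    then show ?thesis
      unfolding eigenvalue_root_char_poly[OF A] es poly_prod_list
      by (force simp: prod_list_zero_iff)
  qed
  with that sim ut B show ?thesis by blast
qed

text \<open>The trace is the sum of the diagonal of the Schur form, hence a sum of eigenvalues.
  Phrasing this with a set \<open>L\<close> closed under addition avoids any bookkeeping of
  multiplicities.\<close>

lemma mat_trace_mem_additive:
  assumes A: "A \<in> carrier_mat n n"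
    and ev: "\<And>k. eigenvalue A k \<Longrightarrow> k \<in> L"
    and L: "0 \<in> L" "\<And>a b. a \<in> L \<Longrightarrow> b \<in> L \<Longrightarrow> a + b \<in> L"
  shows "mat_trace A \<in> L"
proof -
  obtain B P Q where B: "similar_mat_wit A B P Q" "B \<in> carrier_mat n n"
    "\<And>i. i < n \<Longrightarrow> eigenvalue A (B $$ (i, i))"
    using complex_schur_form[OF A] by metis
  have "(\<Sum>i\<in>I. B $$ (i, i)) \<in> L" if "finite I" "I \<subseteq> {..<n}" for I
    using that by (induction I rule: finite_induct) (auto intro: L ev B(3))
  then show ?thesis
    using mat_trace_similar[OF A B(1)] B(2) by (auto simp: mat_trace_def)
qed

section \<open>Matrices of finite order and their traces\<close>

text \<open>Induction on the distance \<open>d\<close> from the diagonal: once all entries nearer to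
  the diagonal vanish, the entry of the \<open>k\<close>-th power at distance \<open>d\<close> is
  \<open>k\<close> times that of \<open>T\<close>. Since the \<open>m\<close>-th power is the
  identity and \<open>m > 0\<close>, this entry is zero.\<close>

lemma unipotent_finite_order:
  fixes T :: "complex mat"
  assumes T: "T \<in> carrier_mat n n" and ut: "upper_triangular T"
    and diag: "\<And>i. i < n \<Longrightarrow> T $$ (i, i) = 1"
    and pow: "T ^\<^sub>m m = 1\<^sub>m n" and m: "m > 0"
  shows "T = 1\<^sub>m n"
proof -
  have low: "T $$ (i, j) = 0" if "j < i" "i < n" for i j
    using ut T that by auto
  have "\<forall>i j. j < n \<longrightarrow> i < j \<longrightarrow> j - i = d \<longrightarrow> T $$ (i, j) = 0" for d
  proof (induction d rule: less_induct)
    case (less d)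
    show ?case
    proof (intro allI impI)
      fix i j assume ij: "j < n" "i < j" "j - i = d"
      \<comment> \<open>Strictly below row \<open>i\<close>, column \<open>j\<close> is that of the
        identity: above the diagonal by the induction hypothesis, below it by triangularity.\<close>
      have mid: "T $$ (l, j) = (if l = j then 1 else 0)" if "i < l" "l < n" for l
        using less.IH[rule_format, of "j - l" j l] low[of j l] diag ij that
        by (cases l j rule: linorder_cases) auto
      \<comment> \<open>The second conjunct kills the terms with \<open>r < i\<close> when the next
        power is expanded, so that only \<open>r = i\<close> and \<open>r = j\<close>
        contribute.\<close>
      have "(T ^\<^sub>m k) $$ (i, j) = of_nat k * T $$ (i, j) \<and>
            (\<forall>l\<le>i. (T ^\<^sub>m k) $$ (i, l) = (if i = l then 1 else 0))" for k
      proof (induction k)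
        case 0
        then show ?case using ij T by auto
      next
        case (Suc k)
        have expand: "(T ^\<^sub>m Suc k) $$ (i, l) = (\<Sum>r<n. (T ^\<^sub>m k) $$ (i, r) * T $$ (r, l))"
          if "l < n" for l
          using ij T that by (simp add: mat_mult_index_sum[of _ n n _ n] del: index_mult_mat(1))
        have "(T ^\<^sub>m Suc k) $$ (i, l) = (if i = l then 1 else 0)" if "l \<le> i" for l
        proof -
          have "(T ^\<^sub>m Suc k) $$ (i, l) = (\<Sum>r<n. if r = l then (T ^\<^sub>m k) $$ (i, l) else 0)"
            unfolding expand[OF order.strict_trans1[OF that order.strict_trans[OF ij(2,1)]]]
          proof (rule sum.cong[OF refl])
            fix r assume "r \<in> {..<n}"
            then show "(T ^\<^sub>m k) $$ (i, r) * T $$ (r, l) = (if r = l then (T ^\<^sub>m k) $$ (i, l) else 0)"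
              using Suc.IH low[of l r] diag[of r] that
              by (cases r l rule: linorder_cases) auto
          qed
          then show ?thesis using Suc.IH that ij by auto
        qed
        moreover have "(T ^\<^sub>m Suc k) $$ (i, j) = of_nat (Suc k) * T $$ (i, j)"
        proof -
          have "(T ^\<^sub>m Suc k) $$ (i, j)
              = (\<Sum>r<n. (if r = i then T $$ (i, j) else 0) + (if r = j then (T ^\<^sub>m k) $$ (i, j) else 0))"
            unfolding expand[OF ij(1)]
          proof (rule sum.cong[OF refl])
            fix r assume "r \<in> {..<n}"
            then show "(T ^\<^sub>m k) $$ (i, r) * T $$ (r, j)
              = (if r = i then T $$ (i, j) else 0) + (if r = j then (T ^\<^sub>m k) $$ (i, j) else 0)"
              using Suc.IH mid[of r] ij by (cases r i rule: linorder_cases) auto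
          qed
          also have "\<dots> = of_nat (Suc k) * T $$ (i, j)"
            using ij Suc.IH by (simp add: sum.distrib algebra_simps)
          finally show ?thesis .
        qed
        ultimately show ?case by blast
      qed
      from this[of m] show "T $$ (i, j) = 0" using pow m ij T by auto
    qed
  qed
  with low diag T show ?thesis
    by (intro eq_matI) (auto, metis linorder_neqE_nat)
qed

text \<open>The real parts are at most 1 and add up to \<open>card I\<close>, so each of them is 1,
  and the modulus leaves no room for an imaginary part.\<close>

lemma sum_unit_eq_card:
  fixes f :: "'i \<Rightarrow> complex"
  assumes "finite I" "\<And>i. i \<in> I \<Longrightarrow> cmod (f i) = 1" "(\<Sum>i\<in>I. f i) = of_nat (card I)" "i \<in> I"
  shows "f i = 1"
proof -
  have le: "Re (f i) \<le> 1" if "i \<in> I" for i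
    using complex_Re_le_cmod[of "f i"] assms(2)[OF that] by simp
  have "(\<Sum>i\<in>I. 1 - Re (f i)) = 0"
    using arg_cong[OF assms(3), of Re] by (simp add: sum_subtractf)
  then have "Re (f i) = 1"
    using sum_nonneg_eq_0_iff[of I "\<lambda>i. 1 - Re (f i)"] le assms(1,4) by auto
  moreover from this assms(2)[OF assms(4)] have "Im (f i) = 0"
    by (simp add: cmod_def)
  ultimately show ?thesis by (simp add: complex_eq_iff)
qed

lemma mat_pow_similar_one:
  fixes A :: "complex mat"
  assumes A: "A \<in> carrier_mat n n" and sim: "similar_mat_wit A B P Q" and pow: "A ^\<^sub>m m = 1\<^sub>m n"
  shows "B ^\<^sub>m m = 1\<^sub>m n"
proof -
  have sim': "similar_mat_wit B A Q P" using similar_mat_wit_sym[OF sim] .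
  from similar_mat_witD2[OF A sim]
  have *: "Q * P = 1\<^sub>m n" "P \<in> carrier_mat n n" "Q \<in> carrier_mat n n" by auto
  have "B ^\<^sub>m m = Q * (A ^\<^sub>m m) * P"
    using similar_mat_wit_pow_id[OF sim'] .
  then show ?thesis using * by (simp add: pow)
qed

text \<open>The eigenvalues are roots of unity, and a trace equal to the dimension forces all of
  them to be 1. The Schur form is then unipotent of finite order, hence the identity.\<close>

lemma finite_order_trace_eq_dim:
  fixes A :: "complex mat"
  assumes A: "A \<in> carrier_mat n n" and pow: "A ^\<^sub>m m = 1\<^sub>m n" and m: "m > 0"
    and tr: "mat_trace A = of_nat n"
  shows "A = 1\<^sub>m n"
proof -
  obtain B P Q where sim: "similar_mat_wit A B P Q" and ut: "upper_triangular B"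
    and B: "B \<in> carrier_mat n n" and ev: "\<And>i. i < n \<Longrightarrow> eigenvalue A (B $$ (i, i))"
    using complex_schur_form[OF A] by metis
  have unit: "cmod (B $$ (i, i)) = 1" if i: "i < n" for i
  proof -
    obtain v where v: "eigenvector A v (B $$ (i, i))"
      using ev[OF i] by (auto simp: eigenvalue_def)
    then have vc: "v \<in> carrier_vec n" "v \<noteq> 0\<^sub>v n" using A by (auto simp: eigenvector_def)
    from eigenvector_pow[OF A v, of m] have eq: "v = (B $$ (i, i)) ^ m \<cdot>\<^sub>v v"
      using vc by (simp add: pow)
    obtain l where l: "l < n" "v $ l \<noteq> 0" using vc by (auto simp: vec_eq_iff)
    have "v $ l = (B $$ (i, i)) ^ m * v $ l"
      using arg_cong[OF eq, of "\<lambda>x. x $ l"] l vc by simp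
    then have "(B $$ (i, i)) ^ m = 1" using l by simp
    then show ?thesis using m by (metis norm_one norm_power power_eq_1_iff norm_ge_zero gr_implies_not0)
  qed
  have "(\<Sum>i<n. B $$ (i, i)) = of_nat (card {..<n})"
    using mat_trace_similar[OF A sim] tr B by (simp add: mat_trace_def)
  then have "B $$ (i, i) = 1" if "i < n" for i
    using sum_unit_eq_card[of "{..<n}" "\<lambda>i. B $$ (i, i)" i] unit that by auto
  then have "B = 1\<^sub>m n"
    using unipotent_finite_order[OF B ut _ mat_pow_similar_one[OF A sim pow] m] by blast
  then show ?thesis
    using similar_mat_witD2[OF A sim] by auto
qed

section \<open>Subspaces as ranges of injective matrices\<close>

text \<open>Otherwise pad \<open>Q\<close> with zero rows to a square matrix \<open>B\<close>. Row
  \<open>n\<close> of \<open>B\<close> vanishes, so \<open>B\<close> is singular, and a kernel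
  vector of \<open>B\<close> is also one of \<open>Q\<close>.\<close>

lemma injective_mat_dims:
  fixes Q :: "complex mat"
  assumes Q: "Q \<in> carrier_mat n m"
    and inj: "\<And>x. x \<in> carrier_vec m \<Longrightarrow> Q *\<^sub>v x = 0\<^sub>v n \<Longrightarrow> x = 0\<^sub>v m"
  shows "m \<le> n"
proof (rule ccontr)
  assume "\<not> m \<le> n"
  define B where "B = mat m m (\<lambda>(i, j). if i < n then Q $$ (i, j) else 0)"
  have B: "B \<in> carrier_mat m m" by (simp add: B_def)
  have "B\<^sup>T *\<^sub>v unit_vec m n = 0\<^sub>v m"
    using \<open>\<not> m \<le> n\<close> by (intro eq_vecI) (auto simp: B_def)
  moreover have "unit_vec m n \<noteq> (0\<^sub>v m :: complex vec)"
    using \<open>\<not> m \<le> n\<close> by (auto simp: vec_eq_iff intro!: exI[of _ n])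
  ultimately have "det (B\<^sup>T) = 0"
    using B by (subst det_0_iff_vec_prod_zero_field[of _ m]) (auto intro!: exI[of _ "unit_vec m n"])
  then have "det B = 0" using det_transpose[OF B] by simp
  then obtain v where v: "v \<in> carrier_vec m" "v \<noteq> 0\<^sub>v m" "B *\<^sub>v v = 0\<^sub>v m"
    using det_0_iff_vec_prod_zero_field[OF B] by auto
  have "(Q *\<^sub>v v) $ i = (B *\<^sub>v v) $ i" if "i < n" for i
    using that Q \<open>\<not> m \<le> n\<close> v(1) by (auto simp: B_def scalar_prod_def)
  then have "Q *\<^sub>v v = 0\<^sub>v n"
    using v(3) Q \<open>\<not> m \<le> n\<close> by (intro eq_vecI) auto
  with inj v show False by blast
qed

lemma injective_square_mat_surj:
  fixes Q :: "complex mat"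
  assumes Q: "Q \<in> carrier_mat n n"
    and inj: "\<And>x. x \<in> carrier_vec n \<Longrightarrow> Q *\<^sub>v x = 0\<^sub>v n \<Longrightarrow> x = 0\<^sub>v n"
    and v: "v \<in> carrier_vec n"
  shows "\<exists>x \<in> carrier_vec n. Q *\<^sub>v x = v"
proof -
  have "det Q \<noteq> 0" using det_0_iff_vec_prod_zero_field[OF Q] inj by auto
  then obtain B where B: "B \<in> carrier_mat n n" "Q * B = 1\<^sub>m n"
    using det_non_zero_imp_unit[OF Q, of "()"] by (auto simp: Units_def ring_mat_simps)
  have "Q *\<^sub>v (B *\<^sub>v v) = v" using B Q v by (simp flip: assoc_mult_mat_vec)
  then show ?thesis using B v by (intro bexI[of _ "B *\<^sub>v v"]) auto
qed

text \<open>An elementwise form of the library notion used in \<open>irreducible_rep\<close>; the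
  next lemma shows that the two agree.\<close>

definition vec_subspace :: "nat \<Rightarrow> complex vec set \<Rightarrow> bool" where
  "vec_subspace n W \<longleftrightarrow> W \<subseteq> carrier_vec n \<and> 0\<^sub>v n \<in> W \<and> (\<forall>v\<in>W. \<forall>w\<in>W. v + w \<in> W) \<and>
     (\<forall>c. \<forall>v\<in>W. c \<cdot>\<^sub>v v \<in> W)"

lemma vec_subspace_iff:
  "VectorSpace.subspace class_ring W (module_vec TYPE(complex) n) \<longleftrightarrow> vec_subspace n W"
  using vec_vs[where ?'a = complex, of n] vec_module[where ?'a = complex, of n]
  by (auto simp: VectorSpace.subspace_def submodule_def vec_subspace_def module_vec_simps
      class_ring_simps)

lemma append_col_mult_vec:
  fixes Q :: "complex mat"
  assumes Q: "Q \<in> carrier_mat n m" and w: "w \<in> carrier_vec n" and x: "x \<in> carrier_vec (Suc m)"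
  shows "mat n (Suc m) (\<lambda>(i, j). if j < m then Q $$ (i, j) else w $ i) *\<^sub>v x
    = Q *\<^sub>v vec m (\<lambda>j. x $ j) + x $ m \<cdot>\<^sub>v w"
  using assms by (intro eq_vecI) (auto simp: scalar_prod_def intro!: sum.cong)

text \<open>The columns of \<open>Q\<close> form a basis of \<open>W\<close>. Take the largest
  \<open>m\<close> for which some injective matrix with \<open>m\<close> columns maps into
  \<open>W\<close>; a vector of \<open>W\<close> outside its range could be appended as a further
  column without losing injectivity.\<close>

lemma vec_subspace_basis_mat:
  assumes W: "vec_subspace n W"
  obtains m Q where "Q \<in> carrier_mat n m" "m \<le> n"
    "\<And>x. x \<in> carrier_vec m \<Longrightarrow> Q *\<^sub>v x = 0\<^sub>v n \<Longrightarrow> x = 0\<^sub>v m"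
    "W = (\<lambda>x. Q *\<^sub>v x) ` carrier_vec m"
proof -
  define P where "P m \<longleftrightarrow> (\<exists>Q \<in> carrier_mat n m.
     (\<forall>x \<in> carrier_vec m. Q *\<^sub>v x = 0\<^sub>v n \<longrightarrow> x = 0\<^sub>v m) \<and> (\<forall>x \<in> carrier_vec m. Q *\<^sub>v x \<in> W))" for m
  have bound: "m \<le> n" if "P m" for m
    using that injective_mat_dims unfolding P_def by blast
  have "0\<^sub>m n 0 *\<^sub>v x = (0\<^sub>v n :: complex vec)" if "x \<in> carrier_vec 0" for x
    using that by (intro eq_vecI) (auto simp: scalar_prod_def)
  then have "P 0"
    unfolding P_def using W
    by (intro bexI[of _ "0\<^sub>m n 0"]) (auto simp: vec_subspace_def)
  define m where "m = (GREATEST m. P m)"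
  have "P m" unfolding m_def using \<open>P 0\<close> bound by (rule GreatestI_nat) 
  have max: "k \<le> m" if "P k" for k
    unfolding m_def using that bound by (rule Greatest_le_nat)
  obtain Q where Q: "Q \<in> carrier_mat n m"
    and inj: "\<And>x. x \<in> carrier_vec m \<Longrightarrow> Q *\<^sub>v x = 0\<^sub>v n \<Longrightarrow> x = 0\<^sub>v m"
    and QW: "\<And>x. x \<in> carrier_vec m \<Longrightarrow> Q *\<^sub>v x \<in> W"
    using \<open>P m\<close> unfolding P_def by blast
  have "w \<in> (\<lambda>x. Q *\<^sub>v x) ` carrier_vec m" if w: "w \<in> W" for w
  proof (rule ccontr)
    assume nw: "w \<notin> (\<lambda>x. Q *\<^sub>v x) ` carrier_vec m"
    have wc: "w \<in> carrier_vec n" using w W by (auto simp: vec_subspace_def)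
    define R where "R = mat n (Suc m) (\<lambda>(i, j). if j < m then Q $$ (i, j) else w $ i)"
    have Rx: "R *\<^sub>v x = Q *\<^sub>v vec m (\<lambda>j. x $ j) + x $ m \<cdot>\<^sub>v w" if "x \<in> carrier_vec (Suc m)" for x
      unfolding R_def using append_col_mult_vec[OF Q wc that] .
    have "x = 0\<^sub>v (Suc m)" if x: "x \<in> carrier_vec (Suc m)" and R0: "R *\<^sub>v x = 0\<^sub>v n" for x
    proof -
      let ?y = "vec m (\<lambda>j. x $ j)"
      have xm: "x $ m = 0"
      proof (rule ccontr)
        assume nz: "x $ m \<noteq> 0"
        \<comment> \<open>A kernel vector with nonzero last coordinate could be solved for
          \<open>w\<close>, placing \<open>w\<close> in the range of \<open>Q\<close>.\<close>
        have "Q *\<^sub>v ((- 1 / x $ m) \<cdot>\<^sub>v ?y) = w"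
        proof (rule eq_vecI)
          show "dim_vec (Q *\<^sub>v ((- 1 / x $ m) \<cdot>\<^sub>v ?y)) = dim_vec w" using Q wc by auto
          fix i assume i: "i < dim_vec w"
          then have "(Q *\<^sub>v ?y) $ i + x $ m * w $ i = 0"
            using arg_cong[OF R0, of "\<lambda>v. v $ i"] Rx[OF x] wc Q by simp
          then have "w $ i = (- 1 / x $ m) * (Q *\<^sub>v ?y) $ i"
            using nz by (simp add: field_simps add_eq_0_iff2)
          also have "\<dots> = (Q *\<^sub>v ((- 1 / x $ m) \<cdot>\<^sub>v ?y)) $ i"
            using i Q wc by (subst mult_mat_vec[of Q n m]) auto
          finally show "(Q *\<^sub>v ((- 1 / x $ m) \<cdot>\<^sub>v ?y)) $ i = w $ i" by simp
        qed
        with nw show False by (metis image_eqI smult_carrier_vec vec_carrier)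
      qed
      then have "Q *\<^sub>v ?y = 0\<^sub>v n" using Rx[OF x] R0 wc Q by auto
      then have y: "?y = 0\<^sub>v m" by (intro inj) auto
      show ?thesis
      proof (rule eq_vecI)
        fix i assume "i < dim_vec (0\<^sub>v (Suc m) :: complex vec)"
        then show "x $ i = 0\<^sub>v (Suc m) $ i"
          using xm arg_cong[OF y, of "\<lambda>v. v $ i"] by (cases "i = m") auto
      qed (use x in auto)
    qed
    moreover have "R *\<^sub>v x \<in> W" if x: "x \<in> carrier_vec (Suc m)" for x
      unfolding Rx[OF x] using W QW[of "vec m (\<lambda>j. x $ j)"] w by (auto simp: vec_subspace_def)
    moreover have "R \<in> carrier_mat n (Suc m)" by (simp add: R_def)
    ultimately have "P (Suc m)" unfolding P_def by blast
    with max show False by fastforce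
  qed
  then have "W = (\<lambda>x. Q *\<^sub>v x) ` carrier_vec m" using QW by auto
  with that Q inj bound[OF \<open>P m\<close>] show ?thesis by blast
qed

text \<open>An eigenvalue is a root of the characteristic polynomial, which is monic with integer
  coefficients.\<close>

lemma integer_mat_eigenvalue_algebraic_int:
  fixes A :: "int mat" and k :: complex
  assumes A: "A \<in> carrier_mat n n" and ev: "eigenvalue (map_mat of_int A) k"
  shows "algebraic_int k"
proof -
  have "poly (char_poly (map_mat of_int A)) k = 0"
    using ev A eigenvalue_root_char_poly[of "map_mat of_int A" n k] by auto
  then have "poly (map_poly of_int (char_poly A)) k = 0"
    by (simp add: of_int_hom.char_poly_hom[OF A])
  then show ?thesis
    using degree_monic_char_poly[OF A] unfolding algebraic_int_altdef_ipoly by blast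
qed

subsection \<open>Irreducible representations\<close>

text \<open>Invertibility of \<open>\<rho> g\<close> is witnessed by the value of
  \<open>\<rho>\<close> at the inverse of \<open>g\<close>, so multiplicativity and the value at the
  identity suffice.\<close>

lemma hom_general_linearI:
  assumes G: "group G"
    and carr: "\<And>g. g \<in> carrier G \<Longrightarrow> \<rho> g \<in> carrier_mat n n"
    and mult: "\<And>g h. g \<in> carrier G \<Longrightarrow> h \<in> carrier G \<Longrightarrow> \<rho> (g \<otimes>\<^bsub>G\<^esub> h) = \<rho> g * \<rho> h"
    and one: "\<rho> \<one>\<^bsub>G\<^esub> = 1\<^sub>m n"
  shows "\<rho> \<in> hom G (general_linear n)"
proof -
  interpret group G by (rule G)
  have "\<rho> g \<in> Units (ring_mat TYPE(complex) n ())" if g: "g \<in> carrier G" for g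
    using carr[OF g] carr[of "inv\<^bsub>G\<^esub> g"] mult[of "inv\<^bsub>G\<^esub> g" g] mult[of g "inv\<^bsub>G\<^esub> g"] one g
    by (auto simp: Units_def ring_mat_simps intro!: bexI[of _ "\<rho> (inv\<^bsub>G\<^esub> g)"])
  then show ?thesis
    using mult by (auto simp: hom_def units_of_def ring_mat_simps)
qed

context group
begin

lemma rep_carrier:
  assumes "\<rho> \<in> hom G (general_linear n)" "g \<in> carrier G"
  shows "\<rho> g \<in> carrier_mat n n"
  using assms by (auto simp: hom_def units_of_def Units_def ring_mat_simps)

lemma rep_mult:
  assumes "\<rho> \<in> hom G (general_linear n)" "g \<in> carrier G" "h \<in> carrier G"
  shows "\<rho> (g \<otimes> h) = \<rho> g * \<rho> h"
  using assms by (auto simp: hom_def units_of_def ring_mat_simps)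

lemma rep_one:
  assumes "\<rho> \<in> hom G (general_linear n)"
  shows "\<rho> \<one> = 1\<^sub>m n"
proof -
  interpret R: ring "ring_mat TYPE(complex) n ()" by (rule ring_mat)
  have "group (general_linear n)" by (rule R.units_group)
  from hom_one[OF assms group_axioms this] show ?thesis
    by (simp add: units_of_one ring_mat_simps)
qed

lemma rep_mult_vec:
  assumes "\<rho> \<in> hom G (general_linear n)" "g \<in> carrier G" "h \<in> carrier G" "w \<in> carrier_vec n"
  shows "\<rho> (g \<otimes> h) *\<^sub>v w = \<rho> g *\<^sub>v (\<rho> h *\<^sub>v w)"
  using assoc_mult_mat_vec[OF rep_carrier[OF assms(1,2)] rep_carrier[OF assms(1,3)] assms(4)]
  by (simp add: rep_mult[OF assms(1-3)])

lemma rep_pow: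
  assumes "\<rho> \<in> hom G (general_linear n)" "g \<in> carrier G"
  shows "\<rho> (g [^] k) = \<rho> g ^\<^sub>m k"
  using assms rep_carrier[OF assms]
  by (induction k) (auto simp: rep_one[OF assms(1)] rep_mult[OF assms(1)])

lemma irreducible_repD:
  assumes "irreducible_rep G n \<rho>"
  shows "\<rho> \<in> hom G (general_linear n)" "n > 0"
    "\<And>W. vec_subspace n W \<Longrightarrow> (\<And>g w. g \<in> carrier G \<Longrightarrow> w \<in> W \<Longrightarrow> \<rho> g *\<^sub>v w \<in> W) \<Longrightarrow>
       W = {0\<^sub>v n} \<or> W = carrier_vec n"
  using assms by (auto simp: irreducible_rep_def vec_subspace_iff)

text \<open>Schur's lemma: an eigenspace of an intertwining matrix is invariant.\<close>

lemma schur_scalar: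
  assumes irr: "irreducible_rep G n \<rho>" and M: "M \<in> carrier_mat n n"
    and comm: "\<And>g. g \<in> carrier G \<Longrightarrow> M * \<rho> g = \<rho> g * M"
  obtains k where "M = k \<cdot>\<^sub>m 1\<^sub>m n"
proof -
  note rep = irreducible_repD[OF irr]
  obtain k v where v: "eigenvector M v k"
    using spectrum_non_empty[OF M] rep(2) by (auto simp: spectrum_def eigenvalue_def)
  define W where "W = {w \<in> carrier_vec n. M *\<^sub>v w = k \<cdot>\<^sub>v w}"
  have "vec_subspace n W"
    using M unfolding vec_subspace_def W_def
    by (auto simp: mult_add_distrib_mat_vec[OF M] mult_mat_vec[OF M] smult_add_distrib_vec[of _ n]
        smult_smult_assoc mult.commute)
  moreover have "\<rho> g *\<^sub>v w \<in> W" if g: "g \<in> carrier G" and w: "w \<in> W" for g w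
  proof -
    note gc = rep_carrier[OF rep(1) g]
    have wc: "w \<in> carrier_vec n" "M *\<^sub>v w = k \<cdot>\<^sub>v w" using w by (auto simp: W_def)
    have "M *\<^sub>v (\<rho> g *\<^sub>v w) = \<rho> g *\<^sub>v (M *\<^sub>v w)"
      using comm[OF g] assoc_mult_mat_vec[OF M gc wc(1)] assoc_mult_mat_vec[OF gc M wc(1)] by simp
    then show ?thesis using wc gc by (auto simp: W_def mult_mat_vec[OF gc])
  qed
  ultimately have "W = {0\<^sub>v n} \<or> W = carrier_vec n" by (rule rep(3))
  moreover have "v \<in> W" "v \<noteq> 0\<^sub>v n" using v M by (auto simp: W_def eigenvector_def)
  ultimately have W: "W = carrier_vec n" by auto
  have "M = k \<cdot>\<^sub>m 1\<^sub>m n"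
  proof (rule eq_matI)
    fix i j assume "i < dim_row (k \<cdot>\<^sub>m 1\<^sub>m n)" "j < dim_col (k \<cdot>\<^sub>m 1\<^sub>m n)"
    then have ij: "i < n" "j < n" by auto
    have "unit_vec n j \<in> W" by (simp add: W)
    then have "(M *\<^sub>v unit_vec n j) $ i = (k \<cdot>\<^sub>v unit_vec n j) $ i" by (simp add: W_def)
    then show "M $$ (i, j) = (k \<cdot>\<^sub>m 1\<^sub>m n) $$ (i, j)"
      using ij M by auto
  qed (use M in auto)
  with that show ?thesis by blast
qed

section \<open>Matrix coefficients of representations\<close>

text \<open>Injectivity of the linear map sending \<open>w\<close> to its coefficient function
  \<open>x \<mapsto> c \<bullet> (\<rho> x *\<^sub>v w)\<close> on the group: through
  \<open>c\<close> the representation embeds into a space of functions.\<close>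

definition separating :: "nat \<Rightarrow> ('a \<Rightarrow> complex mat) \<Rightarrow> complex vec \<Rightarrow> bool" where
  "separating n \<rho> c \<longleftrightarrow> c \<in> carrier_vec n \<and>
     (\<forall>w \<in> carrier_vec n. (\<forall>x \<in> carrier G. c \<bullet> (\<rho> x *\<^sub>v w) = 0) \<longrightarrow> w = 0\<^sub>v n)"

text \<open>\<open>\<tau>\<close> is the restriction of \<open>\<rho>\<close> to \<open>W\<close>,
  written in the basis given by the columns of \<open>Q\<close>, and \<open>c'\<close> is
  \<open>c\<close> pulled back along \<open>Q\<close>. Hence every coefficient function of
  \<open>\<tau>\<close> is one of \<open>\<rho>\<close> with a vector taken from
  \<open>W\<close>.\<close>

lemma separating_restrict:
  assumes \<rho>: "\<rho> \<in> hom G (general_linear n)" and sep: "separating n \<rho> c"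
    and W: "vec_subspace n W" and inv: "\<And>g w. g \<in> carrier G \<Longrightarrow> w \<in> W \<Longrightarrow> \<rho> g *\<^sub>v w \<in> W"
    and nz: "W \<noteq> {0\<^sub>v n}"
  obtains m \<tau> c' where "\<tau> \<in> hom G (general_linear m)" "0 < m" "W \<noteq> carrier_vec n \<Longrightarrow> m < n"
    "separating m \<tau> c'"
    "\<And>w'. w' \<in> carrier_vec m \<Longrightarrow> \<exists>w\<in>W. \<forall>x\<in>carrier G. c' \<bullet> (\<tau> x *\<^sub>v w') = c \<bullet> (\<rho> x *\<^sub>v w)"
proof -
  obtain m Q where Q: "Q \<in> carrier_mat n m" and mn: "m \<le> n"
    and inj: "\<And>x. x \<in> carrier_vec m \<Longrightarrow> Q *\<^sub>v x = 0\<^sub>v n \<Longrightarrow> x = 0\<^sub>v m"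
    and ran: "W = (\<lambda>x. Q *\<^sub>v x) ` carrier_vec m"
    using vec_subspace_basis_mat[OF W] by metis
  have c: "c \<in> carrier_vec n" using sep by (simp add: separating_def)
  have inj2: "x = y" if "x \<in> carrier_vec m" "y \<in> carrier_vec m" "Q *\<^sub>v x = Q *\<^sub>v y" for x y
  proof -
    have "Q *\<^sub>v (x - y) = 0\<^sub>v n"
      using that Q by (simp add: mult_minus_distrib_mat_vec[OF Q])
    then have "x - y = 0\<^sub>v m" using that by (intro inj) auto
    show ?thesis
    proof (rule eq_vecI)
      fix i assume "i < dim_vec y"
      then show "x $ i = y $ i"
        using that arg_cong[OF \<open>x - y = 0\<^sub>v m\<close>, of "\<lambda>v. v $ i"] by auto
    qed (use that in auto)
  qed
  have "\<exists>y. y \<in> carrier_vec m \<and> Q *\<^sub>v y = \<rho> g *\<^sub>v col Q j" if "g \<in> carrier G" "j < m" for g j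
  proof -
    have "col Q j = Q *\<^sub>v unit_vec m j"
      using Q that by (intro eq_vecI) auto
    then have "col Q j \<in> W" unfolding ran by auto
    then show ?thesis using inv[OF that(1)] unfolding ran by fastforce
  qed
  \<comment> \<open>\<open>Y g j\<close> holds the coordinates of the image of the
    \<open>j\<close>-th basis vector under \<open>\<rho> g\<close>; it becomes column
    \<open>j\<close> of \<open>\<tau> g\<close>.\<close>
  then obtain Y where Y: "\<And>g j. g \<in> carrier G \<Longrightarrow> j < m \<Longrightarrow> Y g j \<in> carrier_vec m"
    "\<And>g j. g \<in> carrier G \<Longrightarrow> j < m \<Longrightarrow> Q *\<^sub>v Y g j = \<rho> g *\<^sub>v col Q j"
    by metis
  define \<tau> where "\<tau> g = mat m m (\<lambda>(i, j). Y g j $ i)" for g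
  have \<tau>c: "\<tau> g \<in> carrier_mat m m" for g by (simp add: \<tau>_def)
  have col\<tau>: "col (\<tau> g) j = Y g j" if "g \<in> carrier G" "j < m" for g j
    using Y(1)[OF that] that by (intro eq_vecI) (auto simp: \<tau>_def)
  have inter: "Q * \<tau> g = \<rho> g * Q" if g: "g \<in> carrier G" for g
  proof (rule mat_col_eqI)
    fix j assume "j < dim_col (\<rho> g * Q)"
    then have j: "j < m" using Q by simp
    show "col (Q * \<tau> g) j = col (\<rho> g * Q) j"
      using j col_mult2[OF Q \<tau>c j] col_mult2[OF rep_carrier[OF \<rho> g] Q j] Y(2)[OF g j] col\<tau>[OF g j]
      by simp
  qed (use Q rep_carrier[OF \<rho> g] \<tau>c in auto)
  have inter_vec: "Q *\<^sub>v (\<tau> g *\<^sub>v x) = \<rho> g *\<^sub>v (Q *\<^sub>v x)" if g: "g \<in> carrier G" and x: "x \<in> carrier_vec m" for g x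
    using inter[OF g] assoc_mult_mat_vec[OF Q \<tau>c x, of g] assoc_mult_mat_vec[OF rep_carrier[OF \<rho> g] Q x]
    by simp
  \<comment> \<open>Matrix identities for \<open>\<tau>\<close> are tested after applying the
    injective \<open>Q\<close>, where \<open>inter_vec\<close> turns them into identities for
    \<open>\<rho>\<close>.\<close>
  have matI: "A = B" if "A \<in> carrier_mat m m" "B \<in> carrier_mat m m"
    "\<And>x. x \<in> carrier_vec m \<Longrightarrow> Q *\<^sub>v (A *\<^sub>v x) = Q *\<^sub>v (B *\<^sub>v x)" for A B
  proof (rule mat_col_eqI)
    fix j assume "j < dim_col B"
    then have j: "j < m" using that(2) by simp
    have "A *\<^sub>v unit_vec m j = B *\<^sub>v unit_vec m j"
      by (rule inj2[OF _ _ that(3)]) (use that(1,2) in auto)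
    moreover have "col A j = A *\<^sub>v unit_vec m j" "col B j = B *\<^sub>v unit_vec m j"
      using that(1,2) j by (auto intro!: eq_vecI)
    ultimately show "col A j = col B j" by simp
  qed (use that(1,2) in auto)
  have \<tau>: "\<tau> \<in> hom G (general_linear m)"
  proof (rule hom_general_linearI[OF group_axioms])
    fix g h assume gh: "g \<in> carrier G" "h \<in> carrier G"
    show "\<tau> (g \<otimes> h) = \<tau> g * \<tau> h"
    proof (rule matI)
      fix x :: "complex vec" assume x: "x \<in> carrier_vec m"
      have Qx: "Q *\<^sub>v x \<in> carrier_vec n" using Q x by simp
      have hx: "\<tau> h *\<^sub>v x \<in> carrier_vec m" using mult_mat_vec_carrier[OF \<tau>c x] .
      show "Q *\<^sub>v (\<tau> (g \<otimes> h) *\<^sub>v x) = Q *\<^sub>v (\<tau> g * \<tau> h *\<^sub>v x)"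
        unfolding assoc_mult_mat_vec[OF \<tau>c \<tau>c x] inter_vec[OF m_closed[OF gh] x]
          inter_vec[OF gh(1) hx] inter_vec[OF gh(2) x] rep_mult_vec[OF \<rho> gh Qx] ..
    qed (auto intro!: mult_carrier_mat[of _ m m] \<tau>c)
  next
    show "\<tau> \<one> = 1\<^sub>m m"
    proof (rule matI)
      fix x :: "complex vec" assume x: "x \<in> carrier_vec m"
      then show "Q *\<^sub>v (\<tau> \<one> *\<^sub>v x) = Q *\<^sub>v (1\<^sub>m m *\<^sub>v x)"
        using Q by (simp add: inter_vec rep_one[OF \<rho>])
    qed (auto intro!: mult_carrier_mat[of _ m m] \<tau>c)
  qed (rule \<tau>c)
  define c' where "c' = Q\<^sup>T *\<^sub>v c"
  have c': "c' \<in> carrier_vec m" using Q c by (simp add: c'_def)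
  have coef: "c' \<bullet> (\<tau> x *\<^sub>v w) = c \<bullet> (\<rho> x *\<^sub>v (Q *\<^sub>v w))" if x: "x \<in> carrier G" and w: "w \<in> carrier_vec m" for x w
  proof -
    have "c' \<bullet> (\<tau> x *\<^sub>v w) = c \<bullet> (Q *\<^sub>v (\<tau> x *\<^sub>v w))"
      unfolding c'_def by (rule transpose_vec_mult_scalar[OF Q mult_mat_vec_carrier[OF \<tau>c w] c])
    then show ?thesis using inter_vec[OF x w] by simp
  qed
  have sep': "separating m \<tau> c'"
    unfolding separating_def
  proof (intro conjI ballI impI c')
    fix w assume w: "w \<in> carrier_vec m" and "\<forall>x\<in>carrier G. c' \<bullet> (\<tau> x *\<^sub>v w) = 0"
    then have "Q *\<^sub>v w = 0\<^sub>v n"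
      using sep coef Q by (auto simp: separating_def)
    with inj w show "w = 0\<^sub>v m" by blast
  qed
  have "m \<noteq> 0"
  proof
    assume "m = 0"
    then have "w = 0\<^sub>v n" if "w \<in> W" for w
      using that Q unfolding ran by (auto intro!: eq_vecI simp: scalar_prod_def)
    with nz W show False by (auto simp: vec_subspace_def)
  qed
  moreover have "m < n" if "W \<noteq> carrier_vec n"
  proof (rule ccontr)
    assume "\<not> m < n"
    with mn have "m = n" by simp
    then have "v \<in> W" if "v \<in> carrier_vec n" for v
      using injective_square_mat_surj[of Q n v] Q inj that unfolding ran by blast
    with W that show False by (auto simp: vec_subspace_def)
  qed
  moreover have "\<exists>w\<in>W. \<forall>x\<in>carrier G. c' \<bullet> (\<tau> x *\<^sub>v w') = c \<bullet> (\<rho> x *\<^sub>v w)" if "w' \<in> carrier_vec m" for w'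
    using that coef unfolding ran by auto
  ultimately show ?thesis using that \<tau> sep' by blast
qed

text \<open>Descent on the dimension: a proper nonzero invariant subspace carries a smaller
  representation that is still separating, and its coefficients remain among the original
  ones.\<close>

lemma separating_irreducible:
  assumes "\<rho> \<in> hom G (general_linear n)" "separating n \<rho> c" "n > 0"
  shows "\<exists>m \<tau> c'. irreducible_rep G m \<tau> \<and> separating m \<tau> c' \<and>
    (\<forall>w'\<in>carrier_vec m. \<exists>w\<in>carrier_vec n. \<forall>x\<in>carrier G. c' \<bullet> (\<tau> x *\<^sub>v w') = c \<bullet> (\<rho> x *\<^sub>v w))"
  using assms
proof (induction n arbitrary: \<rho> c rule: less_induct)
  case (less n)
  show ?case
  proof (cases "irreducible_rep G n \<rho>")
    case True
    with less.prems show ?thesis by (intro exI[of _ n] exI[of _ \<rho>] exI[of _ c]) auto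
  next
    case False
    then obtain W where W: "vec_subspace n W" "\<And>g w. g \<in> carrier G \<Longrightarrow> w \<in> W \<Longrightarrow> \<rho> g *\<^sub>v w \<in> W"
      "W \<noteq> {0\<^sub>v n}" "W \<noteq> carrier_vec n"
      using less.prems by (auto simp: irreducible_rep_def vec_subspace_iff)
    from separating_restrict[OF less.prems(1,2) W(1,2,3)]
    obtain m \<tau> c' where m: "\<tau> \<in> hom G (general_linear m)" "0 < m" "m < n" "separating m \<tau> c'"
      "\<And>w'. w' \<in> carrier_vec m \<Longrightarrow> \<exists>w\<in>W. \<forall>x\<in>carrier G. c' \<bullet> (\<tau> x *\<^sub>v w') = c \<bullet> (\<rho> x *\<^sub>v w)"
      using W(4) by metis
    from less.IH[OF m(3,1,4,2)] obtain m2 \<tau>2 c2 where *: "irreducible_rep G m2 \<tau>2" "separating m2 \<tau>2 c2"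
      "\<And>w'. w' \<in> carrier_vec m2 \<Longrightarrow> \<exists>w\<in>carrier_vec m. \<forall>x\<in>carrier G. c2 \<bullet> (\<tau>2 x *\<^sub>v w') = c' \<bullet> (\<tau> x *\<^sub>v w)"
      by blast
    have "\<exists>w\<in>carrier_vec n. \<forall>x\<in>carrier G. c2 \<bullet> (\<tau>2 x *\<^sub>v w') = c \<bullet> (\<rho> x *\<^sub>v w)" if "w' \<in> carrier_vec m2" for w'
    proof -
      obtain w1 where w1: "w1 \<in> carrier_vec m" "\<forall>x\<in>carrier G. c2 \<bullet> (\<tau>2 x *\<^sub>v w') = c' \<bullet> (\<tau> x *\<^sub>v w1)"
        using *(3) \<open>w' \<in> carrier_vec m2\<close> by blast
      moreover obtain w2 where "w2 \<in> W" "\<forall>x\<in>carrier G. c' \<bullet> (\<tau> x *\<^sub>v w1) = c \<bullet> (\<rho> x *\<^sub>v w2)"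
        using m(5)[OF w1(1)] by blast
      ultimately show ?thesis using W(1) by (intro bexI[of _ w2]) (auto simp: vec_subspace_def)
    qed
    with * show ?thesis by blast
  qed
qed

text \<open>Translation-invariant function spaces are subrepresentations of the right regular
  representation, on which evaluation at the identity is a separating functional.\<close>

lemma invariant_function_space_contains_irreducible:
  fixes U :: "('a \<Rightarrow> complex) set"
  assumes fin: "finite (carrier G)"
    and zero: "(\<lambda>x. 0) \<in> U"
    and add: "\<And>f g. f \<in> U \<Longrightarrow> g \<in> U \<Longrightarrow> (\<lambda>x. f x + g x) \<in> U"
    and scale: "\<And>a f. f \<in> U \<Longrightarrow> (\<lambda>x. a * f x) \<in> U"
    and trans: "\<And>f g. f \<in> U \<Longrightarrow> g \<in> carrier G \<Longrightarrow> (\<lambda>x. f (x \<otimes> g)) \<in> U"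
    and nz: "f0 \<in> U" "x0 \<in> carrier G" "f0 x0 \<noteq> 0"
  obtains m \<tau> c where "irreducible_rep G m \<tau>" "separating m \<tau> c"
    "\<And>w. w \<in> carrier_vec m \<Longrightarrow> \<exists>f\<in>U. \<forall>x\<in>carrier G. c \<bullet> (\<tau> x *\<^sub>v w) = f x"
proof -
  define N where "N = card (carrier G)"
  obtain e where e: "bij_betw e {0..<N} (carrier G)"
    using ex_bij_betw_nat_finite[OF fin] unfolding N_def by blast
  have eG: "e i \<in> carrier G" if "i < N" for i using e that by (auto simp: bij_betw_def)
  have e_ex: "\<exists>i<N. e i = x" if "x \<in> carrier G" for x using e that unfolding bij_betw_def by force
  have e_inj: "i = j" if "i < N" "j < N" "e i = e j" for i j
    using e that by (auto simp: bij_betw_def inj_on_def)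
  \<comment> \<open>\<open>R\<close> is the right regular representation in the enumeration
    \<open>e\<close>, acting on the vectors of values \<open>V f\<close>.\<close>
  define R where "R g = mat N N (\<lambda>(i, j). if e j = e i \<otimes> g then 1 else 0 :: complex)" for g
  have Rc: "R g \<in> carrier_mat N N" for g by (simp add: R_def)
  define V where "V f = vec N (\<lambda>i. f (e i))" for f :: "'a \<Rightarrow> complex"
  have Vc: "V f \<in> carrier_vec N" for f by (simp add: V_def)
  have V_surj: "\<exists>f. w = V f" if "w \<in> carrier_vec N" for w
    using that e_inj
    by (intro exI[of _ "\<lambda>x. w $ (THE i. i < N \<and> e i = x)"] eq_vecI)
       (auto simp: V_def intro!: arg_cong[of _ _ "($) w"] the_equality[symmetric])
  have V_eq: "V f = V g \<longleftrightarrow> (\<forall>x\<in>carrier G. f x = g x)" for f g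
    using e_ex eG by (auto simp: V_def vec_eq_iff)
  have RV: "R g *\<^sub>v V f = V (\<lambda>x. f (x \<otimes> g))" if g: "g \<in> carrier G" for g f
  proof (rule eq_vecI)
    fix i assume "i < dim_vec (V (\<lambda>x. f (x \<otimes> g)))"
    then have i: "i < N" by (simp add: V_def)
    obtain k where k: "k < N" "e k = e i \<otimes> g" using e_ex[of "e i \<otimes> g"] eG i g by auto
    have "(R g *\<^sub>v V f) $ i = (\<Sum>j = 0..<N. (if e j = e i \<otimes> g then 1 else 0) * f (e j))"
      using i by (simp add: R_def V_def scalar_prod_def)
    also have "\<dots> = (\<Sum>j = 0..<N. if j = k then f (e k) else 0)"
      using k e_inj by (intro sum.cong) (auto simp: k(2)[symmetric])
    also have "\<dots> = f (e i \<otimes> g)" using k by simp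
    finally show "(R g *\<^sub>v V f) $ i = V (\<lambda>x. f (x \<otimes> g)) $ i" using i by (simp add: V_def)
  qed (simp add: R_def V_def)
  have matI: "A = B" if "A \<in> carrier_mat N N" "B \<in> carrier_mat N N" "\<And>f. A *\<^sub>v V f = B *\<^sub>v V f" for A B
  proof (rule mat_col_eqI)
    fix j assume "j < dim_col B"
    then have j: "j < N" using that(2) by simp
    obtain f where "unit_vec N j = V f" using V_surj by (metis unit_vec_carrier)
    then have "A *\<^sub>v unit_vec N j = B *\<^sub>v unit_vec N j" using that(3) by simp
    moreover have "col A j = A *\<^sub>v unit_vec N j" "col B j = B *\<^sub>v unit_vec N j"
      using that(1,2) j by (auto intro!: eq_vecI)
    ultimately show "col A j = col B j" by simp
  qed (use that(1,2) in auto)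
  have R: "R \<in> hom G (general_linear N)"
  proof (rule hom_general_linearI[OF group_axioms Rc])
    fix g h assume gh: "g \<in> carrier G" "h \<in> carrier G"
    show "R (g \<otimes> h) = R g * R h"
    proof (rule matI)
      fix f
      show "R (g \<otimes> h) *\<^sub>v V f = R g * R h *\<^sub>v V f"
        using gh eG by (simp add: assoc_mult_mat_vec[OF Rc Rc Vc] RV V_eq m_assoc)
    qed (auto intro!: mult_carrier_mat[of _ N N] Rc)
  next
    show "R \<one> = 1\<^sub>m N"
      using Vc by (intro matI Rc) (auto simp: RV V_eq)
  qed
  obtain i1 where i1: "i1 < N" "e i1 = \<one>" using e_ex by blast
  have ev: "unit_vec N i1 \<bullet> (R x *\<^sub>v V f) = f x" if "x \<in> carrier G" for x f
    unfolding RV[OF that] using that i1 by (simp add: V_def)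
  have sep: "separating N R (unit_vec N i1)"
    unfolding separating_def
  proof (intro conjI ballI impI)
    fix w assume w: "w \<in> carrier_vec N" and 0: "\<forall>x\<in>carrier G. unit_vec N i1 \<bullet> (R x *\<^sub>v w) = 0"
    obtain f where f: "w = V f" using V_surj[OF w] by blast
    with 0 ev have "\<forall>x\<in>carrier G. f x = 0" by auto
    then show "w = 0\<^sub>v N" unfolding f using eG by (intro eq_vecI) (auto simp: V_def)
  qed simp
  define W where "W = V ` U"
  have W: "vec_subspace N W"
    unfolding vec_subspace_def
  proof (intro conjI ballI allI)
    show "W \<subseteq> carrier_vec N" by (auto simp: W_def V_def)
    have "0\<^sub>v N = V (\<lambda>x. 0)" by (intro eq_vecI) (auto simp: V_def)
    then show "0\<^sub>v N \<in> W" using zero by (auto simp: W_def)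
    show "v + w \<in> W" if "v \<in> W" "w \<in> W" for v w
    proof -
      obtain f g where fg: "f \<in> U" "g \<in> U" "v = V f" "w = V g" using \<open>v \<in> W\<close> \<open>w \<in> W\<close> by (auto simp: W_def)
      then have "v + w = V (\<lambda>x. f x + g x)" by (auto simp: V_def)
      then show ?thesis using add fg by (auto simp: W_def)
    qed
    show "a \<cdot>\<^sub>v v \<in> W" if "v \<in> W" for a v
    proof -
      obtain f where f: "f \<in> U" "v = V f" using \<open>v \<in> W\<close> by (auto simp: W_def)
      then have "a \<cdot>\<^sub>v v = V (\<lambda>x. a * f x)" by (auto simp: V_def)
      then show ?thesis using scale f by (auto simp: W_def)
    qed
  qed
  have inv: "R g *\<^sub>v w \<in> W" if "g \<in> carrier G" "w \<in> W" for g w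
    using that trans by (auto simp: W_def RV)
  have "V f0 \<noteq> 0\<^sub>v N"
  proof
    assume "V f0 = 0\<^sub>v N"
    then have "f0 (e i) = 0" if "i < N" for i using that by (auto simp: V_def vec_eq_iff)
    with e_ex nz show False by metis
  qed
  then have Wnz: "W \<noteq> {0\<^sub>v N}" using nz(1) by (auto simp: W_def)
  \<comment> \<open>Restriction to \<open>W\<close> may still be reducible, so a second descent
    follows; the coefficients obtained agree with elements of \<open>U\<close> on the group
    throughout.\<close>
  obtain m \<tau> c where m: "\<tau> \<in> hom G (general_linear m)" "0 < m" "separating m \<tau> c"
      "\<And>w'. w' \<in> carrier_vec m \<Longrightarrow> \<exists>w\<in>W. \<forall>x\<in>carrier G. c \<bullet> (\<tau> x *\<^sub>v w') = unit_vec N i1 \<bullet> (R x *\<^sub>v w)"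
    using separating_restrict[OF R sep W inv Wnz] by metis
  from separating_irreducible[OF m(1,3,2)] obtain m2 \<tau>2 c2
    where *: "irreducible_rep G m2 \<tau>2" "separating m2 \<tau>2 c2"
      "\<And>w'. w' \<in> carrier_vec m2 \<Longrightarrow> \<exists>w\<in>carrier_vec m. \<forall>x\<in>carrier G. c2 \<bullet> (\<tau>2 x *\<^sub>v w') = c \<bullet> (\<tau> x *\<^sub>v w)"
    by blast
  have "\<exists>f\<in>U. \<forall>x\<in>carrier G. c2 \<bullet> (\<tau>2 x *\<^sub>v w) = f x" if w: "w \<in> carrier_vec m2" for w
  proof -
    obtain w1 where w1: "w1 \<in> carrier_vec m" "\<forall>x\<in>carrier G. c2 \<bullet> (\<tau>2 x *\<^sub>v w) = c \<bullet> (\<tau> x *\<^sub>v w1)"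
      using *(3)[OF w] by blast
    obtain w2 where w2: "w2 \<in> W" "\<forall>x\<in>carrier G. c \<bullet> (\<tau> x *\<^sub>v w1) = unit_vec N i1 \<bullet> (R x *\<^sub>v w2)"
      using m(4)[OF w1(1)] by blast
    then obtain f where "f \<in> U" "w2 = V f" by (auto simp: W_def)
    then show ?thesis using w1 w2 ev by (intro bexI[of _ f]) auto
  qed
  with that * show ?thesis by blast
qed

lemma separating_nonzero:
  assumes "irreducible_rep G n \<rho>" "separating n \<rho> c"
  obtains w x where "w \<in> carrier_vec n" "x \<in> carrier G" "c \<bullet> (\<rho> x *\<^sub>v w) \<noteq> 0"
proof -
  have "n > 0" using irreducible_repD(2)[OF assms(1)] .
  then have "unit_vec n 0 \<noteq> (0\<^sub>v n :: complex vec)"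
    by (auto simp: vec_eq_iff intro!: exI[of _ 0])
  then obtain x where "x \<in> carrier G" "c \<bullet> (\<rho> x *\<^sub>v unit_vec n 0) \<noteq> 0"
    using assms(2) unfolding separating_def by (metis unit_vec_carrier)
  then show ?thesis using that[of "unit_vec n 0"] by auto
qed

text \<open>The functions orthogonal to all coefficients form a space \<open>U\<close> invariant
  under right translations. If \<open>U\<close> were nonzero on the group, it would contain a
  nonzero coefficient, which would be orthogonal to itself.\<close>

lemma coefficients_complete:
  fixes f :: "'a \<Rightarrow> complex"
  assumes fin: "finite (carrier G)"
    and orth: "\<And>n \<rho> c w. irreducible_rep G n \<rho> \<Longrightarrow> c \<in> carrier_vec n \<Longrightarrow> w \<in> carrier_vec n \<Longrightarrow>
      (\<Sum>x\<in>carrier G. f x * cnj (c \<bullet> (\<rho> x *\<^sub>v w))) = 0"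
    and x: "x \<in> carrier G"
  shows "f x = 0"
proof (rule ccontr)
  assume "f x \<noteq> 0"
  define U where "U = {f. \<forall>n \<rho> c w. irreducible_rep G n \<rho> \<longrightarrow> c \<in> carrier_vec n \<longrightarrow> w \<in> carrier_vec n \<longrightarrow>
      (\<Sum>x\<in>carrier G. f x * cnj (c \<bullet> (\<rho> x *\<^sub>v w))) = 0}"
  have trans: "(\<lambda>x. h (x \<otimes> g)) \<in> U" if h: "h \<in> U" and g: "g \<in> carrier G" for h g
    unfolding U_def
  proof (intro CollectI allI impI)
    fix n \<rho> and c w :: "complex vec" assume irr: "irreducible_rep G n \<rho>" and cw: "c \<in> carrier_vec n" "w \<in> carrier_vec n"
    note \<rho> = irreducible_repD(1)[OF irr]
    \<comment> \<open>The translation is moved onto the coefficient, where it only replaces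
      \<open>w\<close> by its image under \<open>\<rho> (inv g)\<close>.\<close>
    have "(\<Sum>x\<in>carrier G. h (x \<otimes> g) * cnj (c \<bullet> (\<rho> x *\<^sub>v w)))
        = (\<Sum>x\<in>carrier G. h x * cnj (c \<bullet> (\<rho> (x \<otimes> inv g) *\<^sub>v w)))"
      by (rule sum.reindex_bij_witness[of _ "\<lambda>x. x \<otimes> inv g" "\<lambda>x. x \<otimes> g"])
        (use g in \<open>auto simp: m_assoc\<close>)
    also have "\<dots> = (\<Sum>x\<in>carrier G. h x * cnj (c \<bullet> (\<rho> x *\<^sub>v (\<rho> (inv g) *\<^sub>v w))))"
      using g cw by (intro sum.cong) (auto simp: rep_mult_vec[OF \<rho>])
    also have "\<dots> = 0"
      using h irr cw rep_carrier[OF \<rho>, of "inv g"] g by (auto simp: U_def)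
    finally show "(\<Sum>x\<in>carrier G. h (x \<otimes> g) * cnj (c \<bullet> (\<rho> x *\<^sub>v w))) = 0" .
  qed
  obtain m \<tau> c where irr: "irreducible_rep G m \<tau>" and sep: "separating m \<tau> c"
    and inU: "\<And>w. w \<in> carrier_vec m \<Longrightarrow> \<exists>f\<in>U. \<forall>x\<in>carrier G. c \<bullet> (\<tau> x *\<^sub>v w) = f x"
  proof (rule invariant_function_space_contains_irreducible[OF fin, of U f x])
    show "(\<lambda>x. 0) \<in> U" by (simp add: U_def)
    show "(\<lambda>x. f x + g x) \<in> U" if "f \<in> U" "g \<in> U" for f g
      using that by (auto simp: U_def distrib_right sum.distrib)
    show "(\<lambda>x. a * f x) \<in> U" if "f \<in> U" for a f
      using that by (auto simp: U_def mult.assoc simp flip: sum_distrib_left)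
    show "f \<in> U" using orth by (simp add: U_def)
  qed (use trans x \<open>f x \<noteq> 0\<close> in blast)+
  obtain w y where w: "w \<in> carrier_vec m" and y: "y \<in> carrier G" "c \<bullet> (\<tau> y *\<^sub>v w) \<noteq> 0"
    using separating_nonzero[OF irr sep] .
  obtain h where h: "h \<in> U" "\<And>x. x \<in> carrier G \<Longrightarrow> c \<bullet> (\<tau> x *\<^sub>v w) = h x" using inU[OF w] by blast
  have "(\<Sum>x\<in>carrier G. h x * cnj (c \<bullet> (\<tau> x *\<^sub>v w))) = 0"
    using h(1) irr sep w by (auto simp: U_def separating_def)
  then have "(\<Sum>x\<in>carrier G. complex_of_real ((cmod (h x))\<^sup>2)) = 0"
    by (simp add: h(2) complex_norm_square del: of_real_power)
  then have "(\<Sum>x\<in>carrier G. (cmod (h x))\<^sup>2) = 0"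
    unfolding of_real_sum[symmetric] of_real_eq_0_iff .
  then have "h y = 0" using fin y by (simp add: sum_nonneg_eq_0_iff)
  then show False using h(2) y by simp
qed

text \<open>The difference of the indicator functions of \<open>\<one>\<close> and \<open>g\<close>
  is orthogonal to every coefficient, so it vanishes by completeness.\<close>

lemma irreducibles_faithful:
  assumes fin: "finite (carrier G)" and g: "g \<in> carrier G"
    and triv: "\<And>n \<rho>. irreducible_rep G n \<rho> \<Longrightarrow> \<rho> g = 1\<^sub>m n"
  shows "g = \<one>"
proof (rule ccontr)
  assume "g \<noteq> \<one>"
  define f :: "'a \<Rightarrow> complex" where "f x = (if x = \<one> then 1 else 0) - (if x = g then 1 else 0)" for x
  have "f \<one> = 0"
  proof (rule coefficients_complete[OF fin])
    fix n \<rho> and c w :: "complex vec" assume irr: "irreducible_rep G n \<rho>" "c \<in> carrier_vec n" "w \<in> carrier_vec n"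
    show "(\<Sum>x\<in>carrier G. f x * cnj (c \<bullet> (\<rho> x *\<^sub>v w))) = 0"
      using fin g triv[OF irr(1)] rep_one[OF irreducible_repD(1)[OF irr(1)]]
      by (simp add: f_def left_diff_distrib sum_subtractf if_distrib[of "\<lambda>x. x * _"] cong: if_cong)
  qed simp
  with \<open>g \<noteq> \<one>\<close> show False by (simp add: f_def)
qed

end

subsection \<open>Matrices indexed by a finite set\<close>

definition eigenfunction_on :: "'a set \<Rightarrow> ('a \<Rightarrow> 'a \<Rightarrow> complex) \<Rightarrow> ('a \<Rightarrow> complex) \<Rightarrow> complex \<Rightarrow> bool" where
  "eigenfunction_on V M f k \<longleftrightarrow> (\<exists>x\<in>V. f x \<noteq> 0) \<and> (\<forall>x\<in>V. mat_vec_on V M f x = k * f x)"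

text \<open>Carries eigenvectors of the enumerated matrix back to functions on \<open>V\<close>, so
  that trace facts about matrices become available there.\<close>

lemma eigenvalue_enumerated:
  assumes e: "bij_betw e {0..<N} V" and ev: "eigenvalue (mat N N (\<lambda>(i, j). M (e i) (e j))) k"
  obtains f where "eigenfunction_on V M f k"
proof -
  let ?M = "mat N N (\<lambda>(i, j). M (e i) (e j))"
  obtain w where w: "w \<in> carrier_vec N" "w \<noteq> 0\<^sub>v N" "?M *\<^sub>v w = k \<cdot>\<^sub>v w"
    using ev by (auto simp: eigenvalue_def eigenvector_def)
  define f where "f x = w $ the_inv_into {0..<N} e x" for x
  have inj: "inj_on e {0..<N}" and img: "V = e ` {0..<N}" using e by (auto simp: bij_betw_def)
  have fe: "f (e i) = w $ i" if "i < N" for i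
    using that by (simp add: f_def the_inv_into_f_f[OF inj])
  obtain i where i: "i < N" "w $ i \<noteq> 0" using w by (auto simp: vec_eq_iff)
  have "\<exists>x\<in>V. f x \<noteq> 0" using fe i by (auto simp: img)
  moreover have "mat_vec_on V M f (e i) = k * f (e i)" if i: "i < N" for i
  proof -
    have "mat_vec_on V M f (e i) = (\<Sum>j = 0..<N. M (e i) (e j) * f (e j))"
      unfolding mat_vec_on_def img by (simp add: sum.reindex[OF inj])
    also have "\<dots> = (\<Sum>j = 0..<N. M (e i) (e j) * w $ j)"
      by (intro sum.cong) (auto simp: fe)
    also have "\<dots> = (?M *\<^sub>v w) $ i"
      using w(1) i by (auto simp: scalar_prod_def intro!: sum.cong)
    also have "\<dots> = k * f (e i)" using w i by (simp add: fe)
    finally show ?thesis .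
  qed
  ultimately show ?thesis using that[of f] by (auto simp: eigenfunction_on_def img)
qed

lemma trace_on_mem_additive:
  assumes fin: "finite V"
    and ev: "\<And>k f. eigenfunction_on V M f k \<Longrightarrow> k \<in> L"
    and L: "0 \<in> L" "\<And>a b. a \<in> L \<Longrightarrow> b \<in> L \<Longrightarrow> a + b \<in> L"
  shows "(\<Sum>x\<in>V. M x x) \<in> L"
proof -
  obtain e where e: "bij_betw e {0..<card V} V"
    using ex_bij_betw_nat_finite[OF fin] by blast
  let ?M = "mat (card V) (card V) (\<lambda>(i, j). M (e i) (e j))"
  have "mat_trace ?M \<in> L"
    by (rule mat_trace_mem_additive[of _ "card V"])
       (use L ev eigenvalue_enumerated[OF e] in \<open>auto, metis\<close>)
  also have "mat_trace ?M = (\<Sum>i = 0..<card V. M (e i) (e i))"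
    by (simp add: mat_trace_def lessThan_atLeast0)
  also have "\<dots> = (\<Sum>x\<in>V. M x x)"
    by (rule sum.reindex_bij_betw[OF e])
  finally show ?thesis .
qed

lemma integer_eigenfunction_algebraic_int:
  assumes fin: "finite V" and int: "\<And>x y. M x y = of_int (Z x y)"
    and ev: "eigenfunction_on V M f k"
  shows "algebraic_int k"
proof -
  obtain e where e: "bij_betw e {0..<card V} V"
    using ex_bij_betw_nat_finite[OF fin] by blast
  define B where "B = mat (card V) (card V) (\<lambda>(i, j). Z (e i) (e j))"
  have B: "B \<in> carrier_mat (card V) (card V)" by (simp add: B_def)
  define w where "w = vec (card V) (\<lambda>i. f (e i))"
  have "eigenvector (map_mat of_int B) w k"
    unfolding eigenvector_def
  proof (intro conjI)
    show "w \<in> carrier_vec (dim_row (map_mat of_int B :: complex mat))" by (simp add: w_def B_def)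
    obtain x where "x \<in> V" "f x \<noteq> 0" using ev by (auto simp: eigenfunction_on_def)
    then obtain i where "i < card V" "f (e i) \<noteq> 0" using e unfolding bij_betw_def by force
    then show "w \<noteq> 0\<^sub>v (dim_row (map_mat of_int B :: complex mat))"
      by (auto simp: w_def B_def vec_eq_iff)
    show "map_mat of_int B *\<^sub>v w = k \<cdot>\<^sub>v w"
    proof (rule eq_vecI)
      fix i assume "i < dim_vec (k \<cdot>\<^sub>v w)"
      then have i: "i < card V" by (simp add: w_def)
      have "(map_mat of_int B *\<^sub>v w) $ i = (\<Sum>j = 0..<card V. M (e i) (e j) * f (e j))"
        using i by (auto simp: B_def w_def scalar_prod_def int intro!: sum.cong)
      also have "\<dots> = (\<Sum>y\<in>V. M (e i) y * f y)"
        by (rule sum.reindex_bij_betw[OF e])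
      also have "\<dots> = k * f (e i)"
        using ev i e by (auto simp: eigenfunction_on_def mat_vec_on_def bij_betw_def)
      finally show "(map_mat of_int B *\<^sub>v w) $ i = (k \<cdot>\<^sub>v w) $ i" using i by (simp add: w_def)
    qed (simp add: w_def B_def)
  qed
  then show ?thesis
    using integer_mat_eigenvalue_algebraic_int[OF B] by (auto simp: eigenvalue_def)
qed

lemma mat_pow_on_bound:
  assumes "finite V" "\<And>x y. cmod (M x y) \<le> b"
  shows "cmod (mat_pow_on V M k x y) \<le> (real (card V) * b) ^ k"
proof (induction k arbitrary: x)
  case (Suc k)
  have "0 \<le> b" using assms(2) norm_ge_zero order.trans by blast
  have "cmod (mat_pow_on V M (Suc k) x y) \<le> (\<Sum>z\<in>V. cmod (M x z * mat_pow_on V M k z y))"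
    unfolding mat_pow_on.simps mat_mult_on_def by (rule norm_sum)
  also have "\<dots> \<le> (\<Sum>z\<in>V. b * (real (card V) * b) ^ k)"
    unfolding norm_mult using assms Suc \<open>0 \<le> b\<close> by (intro sum_mono mult_mono) auto
  finally show ?case by simp
qed simp

text \<open>By the bound on the entries of powers, the series is dominated by a scalar exponential
  series.\<close>

lemma mat_exp_on_sums:
  assumes "finite V" "\<And>x y. cmod (M x y) \<le> b"
  shows "(\<lambda>k. mat_pow_on V M k x y / fact k) sums mat_exp_on V M x y"
  unfolding mat_exp_on_def
proof (rule summable_sums, rule summable_comparison_test')
  show "summable (\<lambda>k. inverse (fact k) * (real (card V) * b) ^ k)" by (rule summable_exp)
  show "norm (mat_pow_on V M k x y / fact k) \<le> inverse (fact k) * (real (card V) * b) ^ k" for k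
    using mat_pow_on_bound[where k = k and x = x and y = y, OF assms] by (simp add: norm_divide field_simps)
qed

text \<open>Powers of \<open>M\<close> act on \<open>f\<close> by powers of \<open>k\<close>;
  summing over the finite set \<open>V\<close> commutes with the exponential series.\<close>

lemma mat_exp_on_eigenfunction:
  assumes fin: "finite V" and bd: "\<And>x y. cmod (M x y) \<le> b"
    and ev: "\<And>x. x \<in> V \<Longrightarrow> mat_vec_on V M f x = k * f x" and x: "x \<in> V"
  shows "mat_vec_on V (mat_exp_on V M) f x = exp k * f x"
proof -
  have pow: "(\<Sum>y\<in>V. mat_pow_on V M j x y * f y) = k ^ j * f x" if "x \<in> V" for j x
    using that
  proof (induction j arbitrary: x)
    case 0
    then show ?case using fin by (simp add: if_distrib[of "\<lambda>c. c * _"] cong: if_cong)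
  next
    case (Suc j)
    have "(\<Sum>y\<in>V. mat_pow_on V M (Suc j) x y * f y)
        = (\<Sum>y\<in>V. \<Sum>z\<in>V. M x z * (mat_pow_on V M j z y * f y))"
      by (simp add: mat_mult_on_def sum_distrib_right mult.assoc)
    also have "\<dots> = (\<Sum>z\<in>V. M x z * (\<Sum>y\<in>V. mat_pow_on V M j z y * f y))"
      by (subst sum.swap) (simp add: sum_distrib_left)
    also have "\<dots> = (\<Sum>z\<in>V. k ^ j * (M x z * f z))"
      using Suc.IH by (intro sum.cong) auto
    also have "\<dots> = k ^ Suc j * f x"
      using ev[OF Suc.prems] by (simp add: mat_vec_on_def sum_distrib_left[symmetric])
    finally show ?case .
  qed
  have "(\<lambda>j. \<Sum>y\<in>V. mat_pow_on V M j x y / fact j * f y) sums mat_vec_on V (mat_exp_on V M) f x"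
    unfolding mat_vec_on_def by (intro sums_sum sums_mult2 mat_exp_on_sums[OF fin bd])
  also have "(\<lambda>j. \<Sum>y\<in>V. mat_pow_on V M j x y / fact j * f y) = (\<lambda>j. k ^ j /\<^sub>R fact j * f x)"
    using pow[OF x]
    by (auto simp: fun_eq_iff scaleR_conv_of_real divide_inverse mult.assoc mult.left_commute
        sum_distrib_left[symmetric])
  finally show ?thesis
    using sums_unique2 sums_mult2[OF exp_converges, of k "f x"] by blast
qed

text \<open>Every power inherits the symmetry, by reindexing the intermediate vertex of the product
  along \<open>\<pi>\<close>.\<close>

lemma mat_exp_on_automorphism:
  assumes bij: "bij_betw \<pi> V V"
    and aut: "\<And>x y. x \<in> V \<Longrightarrow> y \<in> V \<Longrightarrow> M (\<pi> x) (\<pi> y) = M x y"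
    and xy: "x \<in> V" "y \<in> V"
  shows "mat_exp_on V M (\<pi> x) (\<pi> y) = mat_exp_on V M x y"
proof -
  have "mat_pow_on V M k (\<pi> x) (\<pi> y) = mat_pow_on V M k x y" if "x \<in> V" for k x
    using that
  proof (induction k arbitrary: x)
    case 0
    then show ?case using bij xy by (auto simp: bij_betw_def inj_on_def)
  next
    case (Suc k)
    have "mat_pow_on V M (Suc k) (\<pi> x) (\<pi> y) = (\<Sum>z\<in>V. M (\<pi> x) (\<pi> z) * mat_pow_on V M k (\<pi> z) (\<pi> y))"
      unfolding mat_pow_on.simps mat_mult_on_def
      by (rule sum.reindex_bij_betw[OF bij, symmetric])
    then show ?case using Suc aut by (simp add: mat_mult_on_def)
  qed
  with xy show ?thesis by (simp add: mat_exp_on_def)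
qed

subsection \<open>Characters on central elements\<close>

definition rep_character :: "('a, 'b) monoid_scheme \<Rightarrow> nat \<Rightarrow> ('a \<Rightarrow> complex mat) \<Rightarrow> 'a \<Rightarrow> complex" where
  "rep_character G n \<rho> = (\<lambda>g \<in> carrier G. \<Sum>i<n. \<rho> g $$ (i, i))"

lemma irr_characters_conv:
  "irr_characters G = {rep_character G n \<rho> | n \<rho>. irreducible_rep G n \<rho>}"
  by (simp add: irr_characters_def rep_character_def)

context group
begin

lemma char_degree_rep:
  assumes "irreducible_rep G n \<rho>"
  shows "char_degree G (rep_character G n \<rho>) = of_nat n"
  using rep_one[OF irreducible_repD(1)[OF assms]] by (simp add: char_degree_def rep_character_def)

text \<open>Multiplying \<open>\<rho> z\<close> by the sign reduces the forward direction to a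
  matrix of finite order whose trace equals its dimension, hence the identity.\<close>

lemma character_eq_sign_degree_iff:
  assumes fin: "finite (carrier G)" and irr: "irreducible_rep G n \<rho>" and z: "z \<in> carrier G"
    and \<epsilon>: "\<epsilon> = 1 \<or> \<epsilon> = - 1"
  shows "rep_character G n \<rho> z = \<epsilon> * char_degree G (rep_character G n \<rho>) \<longleftrightarrow> \<rho> z = \<epsilon> \<cdot>\<^sub>m 1\<^sub>m n"
proof
  note \<rho> = irreducible_repD(1)[OF irr]
  note zc = rep_carrier[OF \<rho> z]
  assume tr: "rep_character G n \<rho> z = \<epsilon> * char_degree G (rep_character G n \<rho>)"
  have \<epsilon>\<epsilon>: "\<epsilon> * \<epsilon> = 1" using \<epsilon> by auto
  define B where "B = \<epsilon> \<cdot>\<^sub>m \<rho> z"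
  have B: "B \<in> carrier_mat n n" using zc by (simp add: B_def)
  have "mat_trace B = \<epsilon> * rep_character G n \<rho> z"
    using zc z by (simp add: mat_trace_def B_def rep_character_def sum_distrib_left)
  also have "\<dots> = of_nat n" using tr \<epsilon>\<epsilon> by (simp add: char_degree_rep[OF irr] flip: mult.assoc)
  finally have "mat_trace B = of_nat n" .
  \<comment> \<open>The exponent is doubled because the group order may be odd, in which case the
    sign \<open>- 1\<close> would survive.\<close>
  moreover have "B ^\<^sub>m (2 * Coset.order G) = 1\<^sub>m n"
  proof -
    have "B ^\<^sub>m k = \<epsilon> ^ k \<cdot>\<^sub>m (\<rho> z ^\<^sub>m k)" for k
    proof (induction k)
      case 0
      then show ?case using zc B by (auto intro!: eq_matI)
    next
      case (Suc k)
      have "B ^\<^sub>m Suc k = (\<epsilon> ^ k \<cdot>\<^sub>m (\<rho> z ^\<^sub>m k)) * (\<epsilon> \<cdot>\<^sub>m \<rho> z)" by (simp add: Suc flip: B_def)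
      also have "\<dots> = \<epsilon> ^ Suc k \<cdot>\<^sub>m (\<rho> z ^\<^sub>m k * \<rho> z)"
        using zc by (intro eq_matI) auto
      finally show ?case by simp
    qed
    moreover have "\<rho> z ^\<^sub>m (2 * Coset.order G) = 1\<^sub>m n"
      using rep_pow[OF \<rho> z, of "2 * Coset.order G"] pow_order_eq_1[OF z] rep_one[OF \<rho>] z
      by (simp add: mult.commute[of 2] nat_pow_pow[symmetric])
    moreover have "\<epsilon> ^ (2 * Coset.order G) = 1"
      using \<epsilon>\<epsilon> by (simp add: power_mult power2_eq_square)
    ultimately show ?thesis by (auto intro!: eq_matI)
  qed
  moreover have "2 * Coset.order G > 0" using fin order_gt_0_iff_finite by simp
  ultimately have "B = 1\<^sub>m n" using finite_order_trace_eq_dim[OF B] by blast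
  then have "\<epsilon> \<cdot>\<^sub>m B = \<epsilon> \<cdot>\<^sub>m 1\<^sub>m n" by simp
  moreover have "\<epsilon> \<cdot>\<^sub>m B = \<rho> z" using \<epsilon>\<epsilon> zc by (auto simp: B_def simp flip: mult.assoc intro!: eq_matI)
  ultimately show "\<rho> z = \<epsilon> \<cdot>\<^sub>m 1\<^sub>m n" by simp
next
  assume "\<rho> z = \<epsilon> \<cdot>\<^sub>m 1\<^sub>m n"
  then show "rep_character G n \<rho> z = \<epsilon> * char_degree G (rep_character G n \<rho>)"
    using z by (simp add: char_degree_rep[OF irr]) (simp add: rep_character_def)
qed

lemma central_acts_by_scalar:
  assumes irr: "irreducible_rep G n \<rho>" and z: "z \<in> center G"
  obtains k where "\<rho> z = k \<cdot>\<^sub>m 1\<^sub>m n"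
proof -
  note \<rho> = irreducible_repD(1)[OF irr]
  have zG: "z \<in> carrier G" using z by (simp add: center_def)
  have "\<rho> z * \<rho> g = \<rho> g * \<rho> z" if g: "g \<in> carrier G" for g
    using z g zG rep_mult[OF \<rho>, of z g] rep_mult[OF \<rho>, of g z] by (auto simp: center_def)
  from schur_scalar[OF irr rep_carrier[OF \<rho> zG] this] that show ?thesis by blast
qed

text \<open>Schur's lemma makes \<open>\<rho> z\<close> a scalar, and this scalar squares to 1. It
  is read off at the entry \<open>(0, 0)\<close>, which exists because \<open>n > 0\<close>.\<close>

lemma central_involution_acts_by_sign:
  assumes irr: "irreducible_rep G n \<rho>" and z: "z \<in> center G" "z \<otimes> z = \<one>"
  shows "\<rho> z = 1 \<cdot>\<^sub>m 1\<^sub>m n \<or> \<rho> z = (- 1) \<cdot>\<^sub>m 1\<^sub>m n"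
proof -
  note \<rho> = irreducible_repD(1)[OF irr]
  have zG: "z \<in> carrier G" using z(1) by (simp add: center_def)
  obtain k where k: "\<rho> z = k \<cdot>\<^sub>m 1\<^sub>m n" using central_acts_by_scalar[OF irr z(1)] .
  have "\<rho> z * \<rho> z = 1\<^sub>m n" using rep_mult[OF \<rho> zG zG] rep_one[OF \<rho>] z(2) by metis
  from arg_cong[OF this, of "\<lambda>M. M $$ (0, 0)"] have "k * k = 1"
    unfolding k using irreducible_repD(2)[OF irr] by simp
  then have "k = 1 \<or> k = - 1" by (simp add: square_eq_1_iff)
  with k show ?thesis by auto
qed

text \<open>If \<open>z\<close> acts by a sign in every irreducible representation, then the square
  of \<open>z\<close> and all commutators with \<open>z\<close> act trivially in each of them, and
  faithfulness makes these elements trivial. The converse is Schur's lemma.\<close>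

lemma all_signs_iff_central_involution:
  assumes fin: "finite (carrier G)" and z: "z \<in> carrier G" "z \<noteq> \<one>"
  shows "(\<forall>\<chi>\<in>irr_characters G. \<chi> z = char_degree G \<chi> \<or> \<chi> z = - char_degree G \<chi>)
    \<longleftrightarrow> z \<in> center G \<and> z \<otimes> z = \<one>" (is "?a \<longleftrightarrow> ?b")
proof
  assume b: ?b
  show ?a
  proof
    fix \<chi> assume "\<chi> \<in> irr_characters G"
    then obtain n \<rho> where irr: "irreducible_rep G n \<rho>" and \<chi>: "\<chi> = rep_character G n \<rho>"
      by (auto simp: irr_characters_conv)
    from central_involution_acts_by_sign[OF irr] b
    show "\<chi> z = char_degree G \<chi> \<or> \<chi> z = - char_degree G \<chi>"
      using character_eq_sign_degree_iff[OF fin irr z(1), of 1]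
        character_eq_sign_degree_iff[OF fin irr z(1), of "-1"] by (auto simp: \<chi>)
  qed
next
  assume a: ?a
  have sign: "\<exists>\<epsilon>. (\<epsilon> = 1 \<or> \<epsilon> = - 1) \<and> \<rho> z = \<epsilon> \<cdot>\<^sub>m 1\<^sub>m n" if irr: "irreducible_rep G n \<rho>" for n \<rho>
  proof -
    have "rep_character G n \<rho> \<in> irr_characters G" using irr by (auto simp: irr_characters_conv)
    with a show ?thesis
      using character_eq_sign_degree_iff[OF fin irr z(1), of 1]
        character_eq_sign_degree_iff[OF fin irr z(1), of "-1"] by auto
  qed
  have "z \<otimes> z = \<one>"
  proof (rule irreducibles_faithful[OF fin])
    fix n \<rho> assume irr: "irreducible_rep G n \<rho>"
    obtain \<epsilon> where \<epsilon>: "\<epsilon> = 1 \<or> \<epsilon> = - 1" "\<rho> z = \<epsilon> \<cdot>\<^sub>m 1\<^sub>m n" using sign[OF irr] by blast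
    then show "\<rho> (z \<otimes> z) = 1\<^sub>m n"
      unfolding rep_mult[OF irreducible_repD(1)[OF irr] z(1) z(1)]
      by (auto simp: mult_smult_assoc_mat[of _ n n] intro!: eq_matI)
  qed (use z in simp)
  moreover have "z \<otimes> g = g \<otimes> z" if g: "g \<in> carrier G" for g
  proof -
    have "z \<otimes> g \<otimes> inv (g \<otimes> z) = \<one>"
    proof (rule irreducibles_faithful[OF fin])
      fix n \<rho> assume irr: "irreducible_rep G n \<rho>"
      note \<rho> = irreducible_repD(1)[OF irr]
      obtain \<epsilon> where \<epsilon>: "\<rho> z = \<epsilon> \<cdot>\<^sub>m 1\<^sub>m n" using sign[OF irr] by blast
      note gc = rep_carrier[OF \<rho> g]
      have "\<rho> (z \<otimes> g) = \<rho> (g \<otimes> z)"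
        using gc unfolding rep_mult[OF \<rho> z(1) g] rep_mult[OF \<rho> g z(1)] \<epsilon>
        by (simp add: mult_smult_assoc_mat[of "1\<^sub>m n" n n "\<rho> g" n] mult_smult_distrib[of "\<rho> g" n n "1\<^sub>m n" n])
      then show "\<rho> (z \<otimes> g \<otimes> inv (g \<otimes> z)) = 1\<^sub>m n"
        using g z rep_mult[OF \<rho>, of "z \<otimes> g" "inv (g \<otimes> z)"] rep_mult[OF \<rho>, of "g \<otimes> z" "inv (g \<otimes> z)"]
          rep_one[OF \<rho>] by (simp add: r_inv)
    qed (use g z in simp)
    then show ?thesis using g z by (metis inv_closed inv_equality inv_inv m_closed)
  qed
  ultimately show ?b using z(1) unfolding center_def by blast
qed

lemma ord_eq_2_iff:
  assumes "z \<in> carrier G" "z \<noteq> \<one>"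
  shows "ord z = 2 \<longleftrightarrow> z \<otimes> z = \<one>"
proof
  assume "ord z = 2"
  then show "z \<otimes> z = \<one>" using pow_ord_eq_1[OF assms(1)] assms(1) by (simp add: numeral_2_eq_2)
next
  assume "z \<otimes> z = \<one>"
  then have "z [^] (2 :: nat) = \<one>" using assms(1) by (simp add: numeral_2_eq_2)
  then have "ord z dvd 2" using pow_eq_id[OF assms(1)] by blast
  moreover have "ord z \<noteq> 1" using assms ord_eq_1 by blast
  ultimately show "ord z = 2" by (metis two_is_prime_nat prime_nat_iff)
qed

end

subsection \<open>Quasi-abelian Cayley graphs\<close>

lemma scalar_mat_mult_vec:
  fixes y :: "complex vec"
  assumes "y \<in> carrier_vec n"
  shows "(k \<cdot>\<^sub>m 1\<^sub>m n) *\<^sub>v y = k \<cdot>\<^sub>v y"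
  using assms by (auto intro!: eq_vecI)

lemma (in group) mult_inv_cancel_left:
  assumes "a \<in> carrier G" "b \<in> carrier G"
  shows "a \<otimes> (inv a \<otimes> b) = b" "inv a \<otimes> (a \<otimes> b) = b"
  using assms by (simp_all flip: m_assoc)

lemma (in group) conjugacy_classes_closed:
  assumes "union_of_conjugacy_classes G S" "s \<in> S" "g \<in> carrier G"
  shows "g \<otimes> s \<otimes> inv g \<in> S"
proof -
  obtain X where X: "X \<subseteq> carrier G" "S = (\<Union>x\<in>X. conjugacy_class G x)"
    using assms(1) by (auto simp: union_of_conjugacy_classes_def)
  then obtain x h where xh: "x \<in> X" "h \<in> carrier G" "s = h \<otimes> x \<otimes> inv h"
    using assms(2) by (auto simp: conjugacy_class_def)
  have xG: "x \<in> carrier G" using xh X by auto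
  have "g \<otimes> s \<otimes> inv g = (g \<otimes> h) \<otimes> x \<otimes> inv (g \<otimes> h)"
    using xh xG assms(3) by (simp add: inv_mult_group m_assoc)
  then show ?thesis using X xh assms(3) by (auto simp: conjugacy_class_def)
qed

text \<open>Closure under conjugation is the form in which the hypothesis on conjugacy classes is
  used below.\<close>

locale quasi_abelian_cayley = group G for G :: "('a, 'b) monoid_scheme" (structure) +
  fixes S :: "'a set"
  assumes fin: "finite (carrier G)"
    and S_sub: "S \<subseteq> carrier G"
    and S_inv: "\<And>s. s \<in> S \<Longrightarrow> inv s \<in> S"
    and S_conj: "\<And>s g. s \<in> S \<Longrightarrow> g \<in> carrier G \<Longrightarrow> g \<otimes> s \<otimes> inv g \<in> S"
begin

lemma S_conj_iff:
  assumes "y \<in> carrier G" "g \<in> carrier G"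
  shows "g \<otimes> y \<otimes> inv g \<in> S \<longleftrightarrow> y \<in> S"
proof
  assume "g \<otimes> y \<otimes> inv g \<in> S"
  from S_conj[OF this, of "inv g"] have "inv g \<otimes> (g \<otimes> y \<otimes> inv g) \<otimes> g \<in> S" using assms by simp
  also have "inv g \<otimes> (g \<otimes> y \<otimes> inv g) \<otimes> g = y"
    using assms by (simp add: m_assoc mult_inv_cancel_left)
  finally show "y \<in> S" .
qed (use S_conj assms in auto)

lemma S_inv_iff: "y \<in> carrier G \<Longrightarrow> inv y \<in> S \<longleftrightarrow> y \<in> S"
  using S_inv[of y] S_inv[of "inv y"] by auto

lemma finite_S: "finite S"
  using fin S_sub finite_subset by blast

abbreviation \<Gamma> where "\<Gamma> \<equiv> cayley_graph G S"

abbreviation adj where "adj \<equiv> adjacency_matrix \<Gamma>"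

abbreviation H where "H \<equiv> transition_matrix \<Gamma>"

text \<open>The adjacency operator on functions; \<open>adj_apply\<close> identifies it with the
  matrix action.\<close>

definition nbsum :: "('a \<Rightarrow> complex) \<Rightarrow> 'a \<Rightarrow> complex" where
  "nbsum f x = (\<Sum>s\<in>S. f (s \<otimes> x))"

lemma pverts_cayley: "pverts \<Gamma> = carrier G"
  by (simp add: cayley_graph_def)

text \<open>An unordered edge can be generated from either endpoint. Since \<open>S\<close> is
  closed under inverses, both cases lead to the same condition.\<close>

lemma adj_eq:
  assumes "x \<in> carrier G" "y \<in> carrier G"
  shows "adj x y = (if y \<otimes> inv x \<in> S then 1 else 0)"
proof -
  have "(\<exists>g\<in>carrier G. \<exists>s\<in>S. {x, y} = {g, s \<otimes> g}) \<longleftrightarrow> y \<otimes> inv x \<in> S"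
  proof
    assume "\<exists>g\<in>carrier G. \<exists>s\<in>S. {x, y} = {g, s \<otimes> g}"
    then obtain g s where g: "g \<in> carrier G" "s \<in> S" "{x, y} = {g, s \<otimes> g}" by blast
    have s: "s \<in> carrier G" using g S_sub by auto
    from g(3) consider "x = g" "y = s \<otimes> g" | "y = g" "x = s \<otimes> g" by (auto simp: doubleton_eq_iff)
    then show "y \<otimes> inv x \<in> S"
    proof cases
      case 1
      then show ?thesis using g s by (simp add: m_assoc)
    next
      case 2
      then have "y \<otimes> inv x = inv s" using g s by (simp add: inv_mult_group flip: m_assoc)
      then show ?thesis using g S_inv by simp
    qed
  next
    assume "y \<otimes> inv x \<in> S"
    moreover have "y = (y \<otimes> inv x) \<otimes> x" using assms by (simp add: m_assoc)
    ultimately show "\<exists>g\<in>carrier G. \<exists>s\<in>S. {x, y} = {g, s \<otimes> g}" using assms by metis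
  qed
  then show ?thesis by (simp add: adjacency_matrix_def cayley_graph_def)
qed

lemma sum_left_translates:
  assumes "x \<in> carrier G"
  shows "(\<Sum>y\<in>carrier G. (if y \<otimes> inv x \<in> S then 1 else 0) * f y) = nbsum f x"
proof -
  have "(\<Sum>y\<in>carrier G. (if y \<otimes> inv x \<in> S then 1 else 0) * f y)
      = (\<Sum>y\<in>carrier G. if y \<otimes> inv x \<in> S then f y else 0)"
    by (intro sum.cong) auto
  also have "\<dots> = (\<Sum>y | y \<in> carrier G \<and> y \<otimes> inv x \<in> S. f y)"
    using fin by (simp add: sum.If_cases Int_def)
  also have "\<dots> = nbsum f x"
    unfolding nbsum_def
    by (rule sum.reindex_bij_witness[of _ "\<lambda>s. s \<otimes> x" "\<lambda>y. y \<otimes> inv x"])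
       (use assms S_sub in \<open>auto simp: m_assoc subset_iff\<close>)
  finally show ?thesis .
qed

lemma adj_apply:
  assumes "x \<in> carrier G"
  shows "mat_vec_on (carrier G) adj f x = nbsum f x"
  unfolding mat_vec_on_def using assms
  by (subst sum_left_translates[OF assms, symmetric]) (intro sum.cong, auto simp: adj_eq)

text \<open>Moving the translation by \<open>s\<close> onto the other factor replaces
  \<open>s\<close> by \<open>inv s\<close>, which only permutes \<open>S\<close>.\<close>

lemma nbsum_adjoint:
  "(\<Sum>x\<in>carrier G. nbsum f x * g x) = (\<Sum>x\<in>carrier G. f x * nbsum g x)"
proof -
  have "(\<Sum>x\<in>carrier G. nbsum f x * g x) = (\<Sum>s\<in>S. \<Sum>x\<in>carrier G. f (s \<otimes> x) * g x)"
    unfolding nbsum_def sum_distrib_right by (rule sum.swap)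
  also have "\<dots> = (\<Sum>s\<in>S. \<Sum>x\<in>carrier G. f x * g (inv s \<otimes> x))"
  proof (rule sum.cong[OF refl])
    fix s assume "s \<in> S"
    then have s: "s \<in> carrier G" using S_sub by auto
    show "(\<Sum>x\<in>carrier G. f (s \<otimes> x) * g x) = (\<Sum>x\<in>carrier G. f x * g (inv s \<otimes> x))"
      by (rule sum.reindex_bij_witness[of _ "\<lambda>x. inv s \<otimes> x" "\<lambda>x. s \<otimes> x"])
         (use s in \<open>auto simp flip: m_assoc\<close>)
  qed
  also have "\<dots> = (\<Sum>s\<in>S. \<Sum>x\<in>carrier G. f x * g (s \<otimes> x))"
    by (rule sum.reindex_bij_witness[of _ "\<lambda>s. inv s" "\<lambda>s. inv s"]) (use S_inv S_sub in auto)
  also have "\<dots> = (\<Sum>x\<in>carrier G. f x * nbsum g x)"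
    unfolding nbsum_def sum_distrib_left by (rule sum.swap)
  finally show ?thesis .
qed

text \<open>The pairing of the image of \<open>f\<close> with the conjugate of \<open>f\<close> is
  evaluated in two ways by means of the symmetry of the operator.\<close>

lemma nbsum_eigenvalue_real:
  assumes ev: "\<And>x. x \<in> carrier G \<Longrightarrow> nbsum f x = k * f x" and x: "x \<in> carrier G" "f x \<noteq> 0"
  shows "cnj k = k"
proof -
  define I where "I = (\<Sum>x\<in>carrier G. f x * cnj (f x))"
  have "k * I = (\<Sum>x\<in>carrier G. nbsum f x * cnj (f x))"
    by (simp add: I_def sum_distrib_left ev mult.assoc)
  also have "\<dots> = (\<Sum>x\<in>carrier G. f x * nbsum (\<lambda>x. cnj (f x)) x)" by (rule nbsum_adjoint)
  also have "\<dots> = (\<Sum>x\<in>carrier G. f x * cnj (nbsum f x))" by (simp add: nbsum_def)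
  also have "\<dots> = cnj k * I" by (simp add: I_def sum_distrib_left ev mult_ac)
  finally have "k * I = cnj k * I" .
  moreover have "I \<noteq> 0"
  proof
    assume "I = 0"
    then have "complex_of_real (\<Sum>x\<in>carrier G. (cmod (f x))\<^sup>2) = 0"
      by (simp add: I_def complex_norm_square del: of_real_power)
    then have "(\<Sum>x\<in>carrier G. (cmod (f x))\<^sup>2) = 0" by (simp only: of_real_eq_0_iff)
    then show False using fin x by (simp add: sum_nonneg_eq_0_iff)
  qed
  ultimately show ?thesis by simp
qed

subsection \<open>The eigenvalues of irreducible representations\<close>

text \<open>Indexing the eigenvalue by a representation instead of its character gives direct access
  to Schur's lemma.\<close>

definition eig :: "nat \<Rightarrow> ('a \<Rightarrow> complex mat) \<Rightarrow> complex" where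
  "eig n \<rho> = cayley_eigenvalue G S (rep_character G n \<rho>)"

text \<open>Conjugation permutes \<open>S\<close>, so the sum of the matrices
  \<open>\<rho> s\<close> commutes with the representation and is a scalar by Schur's lemma. Its
  trace identifies the scalar as \<open>eig n \<rho>\<close>.\<close>

lemma class_sum_scalar:
  assumes irr: "irreducible_rep G n \<rho>"
  shows "mat n n (\<lambda>(i, j). \<Sum>s\<in>S. \<rho> s $$ (i, j)) = eig n \<rho> \<cdot>\<^sub>m 1\<^sub>m n" (is "?M = _")
proof -
  note \<rho> = irreducible_repD(1)[OF irr]
  note car = rep_carrier[OF \<rho>]
  have SG: "s \<in> carrier G" if "s \<in> S" for s using that S_sub by auto
  have comm: "?M * \<rho> g = \<rho> g * ?M" if g: "g \<in> carrier G" for g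
  proof (rule eq_matI)
    fix i j assume "i < dim_row (\<rho> g * ?M)" "j < dim_col (\<rho> g * ?M)"
    then have ij: "i < n" "j < n" using car[OF g] by auto
    have "(?M * \<rho> g) $$ (i, j) = (\<Sum>l<n. (\<Sum>s\<in>S. \<rho> s $$ (i, l)) * \<rho> g $$ (l, j))"
      using ij car[OF g] by (subst mat_mult_index_sum[of _ n n _ n]) auto
    also have "\<dots> = (\<Sum>s\<in>S. \<Sum>l<n. \<rho> s $$ (i, l) * \<rho> g $$ (l, j))"
      by (simp add: sum_distrib_right) (rule sum.swap)
    also have "\<dots> = (\<Sum>s\<in>S. \<rho> (s \<otimes> g) $$ (i, j))"
      using ij SG car g by (intro sum.cong) (auto simp: rep_mult[OF \<rho>] mat_mult_index_sum[of _ n n _ n] simp del: index_mult_mat(1))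
    also have "\<dots> = (\<Sum>s\<in>S. \<rho> (g \<otimes> s) $$ (i, j))"
    proof (rule sum.reindex_bij_witness[of _ "\<lambda>s. g \<otimes> s \<otimes> inv g" "\<lambda>s. inv g \<otimes> s \<otimes> g"])
      fix s assume s: "s \<in> S"
      show "inv g \<otimes> s \<otimes> g \<in> S" using S_conj[OF s, of "inv g"] g by simp
      show "g \<otimes> s \<otimes> inv g \<in> S" using S_conj[OF s g] .
      show "g \<otimes> (inv g \<otimes> s \<otimes> g) \<otimes> inv g = s"
        using s g SG by (simp add: m_assoc mult_inv_cancel_left)
      show "inv g \<otimes> (g \<otimes> s \<otimes> inv g) \<otimes> g = s"
        using s g SG by (simp add: m_assoc mult_inv_cancel_left)
      show "\<rho> (g \<otimes> (inv g \<otimes> s \<otimes> g)) $$ (i, j) = \<rho> (s \<otimes> g) $$ (i, j)"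
        using s g SG by (simp flip: m_assoc)
    qed
    also have "\<dots> = (\<Sum>s\<in>S. \<Sum>l<n. \<rho> g $$ (i, l) * \<rho> s $$ (l, j))"
      using ij SG car g by (intro sum.cong) (auto simp: rep_mult[OF \<rho>] mat_mult_index_sum[of _ n n _ n] simp del: index_mult_mat(1))
    also have "\<dots> = (\<Sum>l<n. \<rho> g $$ (i, l) * (\<Sum>s\<in>S. \<rho> s $$ (l, j)))"
      by (simp add: sum_distrib_left) (rule sum.swap)
    also have "\<dots> = (\<rho> g * ?M) $$ (i, j)"
      using ij car[OF g] by (subst mat_mult_index_sum[of _ n n _ n]) auto
    finally show "(?M * \<rho> g) $$ (i, j) = (\<rho> g * ?M) $$ (i, j)" .
  qed (use car[OF g] in auto)
  obtain k where k: "?M = k \<cdot>\<^sub>m 1\<^sub>m n" using schur_scalar[OF irr _ comm] by auto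
  have diag: "(\<Sum>s\<in>S. \<rho> s $$ (i, i)) = k" if "i < n" for i
    using arg_cong[OF k, of "\<lambda>M. M $$ (i, i)"] that by simp
  have "(\<Sum>s\<in>S. rep_character G n \<rho> s) = (\<Sum>i<n. \<Sum>s\<in>S. \<rho> s $$ (i, i))"
    using SG by (simp add: rep_character_def) (rule sum.swap)
  also have "\<dots> = of_nat n * k" by (simp add: diag)
  finally have "eig n \<rho> = k"
    using irreducible_repD(2)[OF irr] by (simp add: eig_def cayley_eigenvalue_def char_degree_rep[OF irr])
  with k show ?thesis by simp
qed

text \<open>The sum over \<open>S\<close> inserts the matrix of \<open>class_sum_scalar\<close> in
  front of \<open>\<rho> x *\<^sub>v w\<close>.\<close>

lemma coefficient_eigenfunction:
  assumes irr: "irreducible_rep G n \<rho>" and cw: "c \<in> carrier_vec n" "w \<in> carrier_vec n"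
    and x: "x \<in> carrier G"
  shows "nbsum (\<lambda>x. c \<bullet> (\<rho> x *\<^sub>v w)) x = eig n \<rho> * (c \<bullet> (\<rho> x *\<^sub>v w))"
proof -
  note \<rho> = irreducible_repD(1)[OF irr]
  note car = rep_carrier[OF \<rho>]
  define y where "y = \<rho> x *\<^sub>v w"
  have y: "y \<in> carrier_vec n" using car[OF x] cw by (simp add: y_def)
  have SG: "s \<in> carrier G" if "s \<in> S" for s using that S_sub by auto
  let ?M = "mat n n (\<lambda>(i, j). \<Sum>s\<in>S. \<rho> s $$ (i, j))"
  have "nbsum (\<lambda>x. c \<bullet> (\<rho> x *\<^sub>v w)) x = (\<Sum>s\<in>S. c \<bullet> (\<rho> s *\<^sub>v y))"
    unfolding nbsum_def y_def using SG x cw by (intro sum.cong) (auto simp: rep_mult_vec[OF \<rho>])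
  also have "\<dots> = (\<Sum>s\<in>S. \<Sum>i<n. \<Sum>j<n. c $ i * (\<rho> s $$ (i, j) * y $ j))"
    using carrier_matD[OF car[OF SG]] y cw
    by (intro sum.cong) (auto simp: scalar_prod_def lessThan_atLeast0 sum_distrib_left intro!: sum.cong)
  also have "\<dots> = (\<Sum>i<n. \<Sum>j<n. \<Sum>s\<in>S. c $ i * (\<rho> s $$ (i, j) * y $ j))"
    by (subst sum.swap, rule sum.cong[OF refl], rule sum.swap)
  also have "\<dots> = c \<bullet> (?M *\<^sub>v y)"
    using y cw by (auto simp: scalar_prod_def lessThan_atLeast0 sum_distrib_left sum_distrib_right intro!: sum.cong)
  also have "?M *\<^sub>v y = eig n \<rho> \<cdot>\<^sub>v y"
    unfolding class_sum_scalar[OF irr] by (rule scalar_mat_mult_vec[OF y])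
  also have "c \<bullet> (eig n \<rho> \<cdot>\<^sub>v y) = eig n \<rho> * (c \<bullet> y)" using cw y by simp
  finally show ?thesis by (simp add: y_def)
qed

text \<open>Supplies an eigenfunction with value 1 at a prescribed vertex: a unit vector is pulled
  back through \<open>\<rho> u\<close> and then paired with itself.\<close>

lemma normalized_coefficient:
  assumes irr: "irreducible_rep G n \<rho>" and u: "u \<in> carrier G"
  obtains c w where "c \<in> carrier_vec n" "w \<in> carrier_vec n" "c \<bullet> (\<rho> u *\<^sub>v w) = 1"
proof -
  note \<rho> = irreducible_repD(1)[OF irr]
  have n: "n > 0" using irreducible_repD(2)[OF irr] .
  define e :: "complex vec" where "e = unit_vec n 0"
  have e: "e \<in> carrier_vec n" by (simp add: e_def)
  define w where "w = \<rho> (inv u) *\<^sub>v e"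
  have w: "w \<in> carrier_vec n" using rep_carrier[OF \<rho>, of "inv u"] u e by (simp add: w_def)
  have "\<rho> u *\<^sub>v w = e"
    using rep_mult_vec[OF \<rho> u inv_closed[OF u] e] u e by (simp add: w_def rep_one[OF \<rho>])
  then have "e \<bullet> (\<rho> u *\<^sub>v w) = 1" using n by (simp add: e_def)
  with that e w show ?thesis by blast
qed

lemma eig_eigenfunction:
  assumes irr: "irreducible_rep G n \<rho>"
  shows "\<exists>f. eigenfunction_on (carrier G) adj f (eig n \<rho>)"
proof -
  obtain c w where cw: "c \<in> carrier_vec n" "w \<in> carrier_vec n" "c \<bullet> (\<rho> \<one> *\<^sub>v w) = 1"
    using normalized_coefficient[OF irr one_closed] .
  then show ?thesis
    using coefficient_eigenfunction[OF irr cw(1,2)]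
    by (intro exI[of _ "\<lambda>x. c \<bullet> (\<rho> x *\<^sub>v w)"]) (auto simp: eigenfunction_on_def adj_apply intro!: bexI[of _ \<one>])
qed

lemma eig_real:
  assumes irr: "irreducible_rep G n \<rho>"
  shows "cnj (eig n \<rho>) = eig n \<rho>"
proof -
  obtain f where "eigenfunction_on (carrier G) adj f (eig n \<rho>)" using eig_eigenfunction[OF irr] ..
  then show ?thesis
    using nbsum_eigenvalue_real[of f "eig n \<rho>"] by (auto simp: eigenfunction_on_def adj_apply)
qed

lemma eig_algebraic_int:
  assumes irr: "irreducible_rep G n \<rho>"
  shows "algebraic_int (eig n \<rho>)"
proof -
  obtain f where "eigenfunction_on (carrier G) adj f (eig n \<rho>)" using eig_eigenfunction[OF irr] ..
  then show ?thesis
    by (rule integer_eigenfunction_algebraic_int[OF fin, where Z = "\<lambda>x y. if (x, y) \<in> parcs \<Gamma> then 1 else 0", rotated])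
       (simp add: adjacency_matrix_def)
qed

lemma central_scalar_coefficient:
  assumes irr: "irreducible_rep G n \<rho>" and z: "z \<in> carrier G" "\<rho> z = k \<cdot>\<^sub>m 1\<^sub>m n"
    and cw: "c \<in> carrier_vec n" "w \<in> carrier_vec n" and x: "x \<in> carrier G"
  shows "c \<bullet> (\<rho> (z \<otimes> x) *\<^sub>v w) = k * (c \<bullet> (\<rho> x *\<^sub>v w))"
proof -
  note \<rho> = irreducible_repD(1)[OF irr]
  have y: "\<rho> x *\<^sub>v w \<in> carrier_vec n" using rep_carrier[OF \<rho> x] cw by simp
  show ?thesis
    unfolding rep_mult_vec[OF \<rho> z(1) x cw(2)] z(2) scalar_mat_mult_vec[OF y]
    using cw carrier_matD(1)[OF rep_carrier[OF \<rho> x]] by (intro scalar_prod_smult_right) auto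
qed

text \<open>The joint eigenspace of the adjacency operator and of a central translation is invariant
  under right translations, so it contains the coefficients of an irreducible representation.\<close>

lemma joint_eigenfunction_irreducible:
  assumes z: "z \<in> center G"
    and ev: "\<And>x. x \<in> carrier G \<Longrightarrow> nbsum f x = \<mu> * f x"
    and zf: "\<And>x. x \<in> carrier G \<Longrightarrow> f (z \<otimes> x) = \<epsilon> * f x"
    and nz: "x0 \<in> carrier G" "f x0 \<noteq> 0"
  obtains n \<rho> where "irreducible_rep G n \<rho>" "eig n \<rho> = \<mu>" "\<rho> z = \<epsilon> \<cdot>\<^sub>m 1\<^sub>m n"
proof -
  have zG: "z \<in> carrier G" using z by (simp add: center_def)
  define U where "U = {f. (\<forall>x\<in>carrier G. nbsum f x = \<mu> * f x) \<and> (\<forall>x\<in>carrier G. f (z \<otimes> x) = \<epsilon> * f x)}"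
  have SG: "s \<in> carrier G" if "s \<in> S" for s using that S_sub by auto
  have trans: "(\<lambda>x. h (x \<otimes> g)) \<in> U" if h: "h \<in> U" and g: "g \<in> carrier G" for h g
  proof -
    have "nbsum (\<lambda>x. h (x \<otimes> g)) x = nbsum h (x \<otimes> g)" if "x \<in> carrier G" for x
      unfolding nbsum_def using SG g that by (intro sum.cong) (auto simp: m_assoc)
    then show ?thesis using h g zG by (auto simp: U_def m_assoc)
  qed
  obtain n \<rho> c where irr: "irreducible_rep G n \<rho>" and sep: "separating n \<rho> c"
    and inU: "\<And>w. w \<in> carrier_vec n \<Longrightarrow> \<exists>f\<in>U. \<forall>x\<in>carrier G. c \<bullet> (\<rho> x *\<^sub>v w) = f x"
  proof (rule invariant_function_space_contains_irreducible[OF fin, of U f x0])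
    show "(\<lambda>x. 0) \<in> U" by (simp add: U_def nbsum_def)
    show "(\<lambda>x. f x + g x) \<in> U" if "f \<in> U" "g \<in> U" for f g
      using that by (auto simp: U_def nbsum_def sum.distrib distrib_left)
    show "(\<lambda>x. a * f x) \<in> U" if "f \<in> U" for a f
      using that by (auto simp: U_def nbsum_def mult.left_commute simp flip: sum_distrib_left)
    show "f \<in> U" using ev zf by (simp add: U_def)
  qed (use trans nz in blast)+
  have c: "c \<in> carrier_vec n" using sep by (simp add: separating_def)
  obtain w y where w: "w \<in> carrier_vec n" and y: "y \<in> carrier G" "c \<bullet> (\<rho> y *\<^sub>v w) \<noteq> 0"
    using separating_nonzero[OF irr sep] .
  obtain h where h: "h \<in> U" "\<And>x. x \<in> carrier G \<Longrightarrow> c \<bullet> (\<rho> x *\<^sub>v w) = h x" using inU[OF w] by blast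
  have "nbsum h y = nbsum (\<lambda>x. c \<bullet> (\<rho> x *\<^sub>v w)) y"
    unfolding nbsum_def using SG y h(2) by (intro sum.cong) auto
  then have "\<mu> * h y = eig n \<rho> * h y"
    using coefficient_eigenfunction[OF irr c w y(1)] h y by (simp add: U_def)
  then have 1: "eig n \<rho> = \<mu>" using y h(2) by simp
  \<comment> \<open>Schur's lemma gives some scalar; comparing values at \<open>y\<close>, where
    \<open>h\<close> does not vanish, shows that it is \<open>\<epsilon>\<close>.\<close>
  obtain k where k: "\<rho> z = k \<cdot>\<^sub>m 1\<^sub>m n" using central_acts_by_scalar[OF irr z] .
  have "h (z \<otimes> y) = k * h y"
    using central_scalar_coefficient[OF irr zG k c w y(1)] h(2) y(1) zG by simp
  then have "k = \<epsilon>" using h y zG by (simp add: U_def)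
  with that irr 1 k show ?thesis by blast
qed

text \<open>With the identity as central element, the joint eigenspace is just an eigenspace of the
  adjacency operator.\<close>

lemma graph_eigenvalue_is_eig:
  assumes "graph_eigenvalue \<Gamma> \<mu>"
  obtains n \<rho> where "irreducible_rep G n \<rho>" "eig n \<rho> = \<mu>"
proof -
  obtain f x where "x \<in> carrier G" "f x \<noteq> 0" "\<And>x. x \<in> carrier G \<Longrightarrow> nbsum f x = \<mu> * f x"
    using assms by (auto simp: graph_eigenvalue_def pverts_cayley adj_apply)
  moreover have "\<one> \<in> center G" by (simp add: center_def)
  ultimately show ?thesis
    using joint_eigenfunction_irreducible[of \<one> f \<mu> 1 x] that by auto
qed

subsection \<open>The transition matrix\<close>

lemma transition_eigenfunction:
  assumes ev: "\<And>x. x \<in> carrier G \<Longrightarrow> nbsum f x = \<mu> * f x" and x: "x \<in> carrier G"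
  shows "(\<Sum>y\<in>carrier G. H t x y * f y) = exp (\<i> * complex_of_real t * \<mu>) * f x"
proof -
  have "mat_vec_on (carrier G) (\<lambda>x y. \<i> * complex_of_real t * adj x y) f x = \<i> * complex_of_real t * \<mu> * f x"
    if "x \<in> carrier G" for x
    using adj_apply[OF that, of f] ev[OF that]
    by (simp add: mat_vec_on_def mult.assoc flip: sum_distrib_left)
  moreover have "cmod (\<i> * complex_of_real t * adj x y) \<le> \<bar>t\<bar>" for x y
    by (simp add: adjacency_matrix_def norm_mult)
  ultimately show ?thesis
    using mat_exp_on_eigenfunction[OF fin, of "\<lambda>x y. \<i> * complex_of_real t * adj x y" "\<bar>t\<bar>" f] x
    by (simp add: transition_matrix_def pverts_cayley mat_vec_on_def)
qed

lemma transition_automorphism: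
  assumes bij: "bij_betw \<pi> (carrier G) (carrier G)"
    and aut: "\<And>x y. x \<in> carrier G \<Longrightarrow> y \<in> carrier G \<Longrightarrow> \<pi> y \<otimes> inv (\<pi> x) \<in> S \<longleftrightarrow> y \<otimes> inv x \<in> S"
    and xy: "x \<in> carrier G" "y \<in> carrier G"
  shows "H t (\<pi> x) (\<pi> y) = H t x y"
  unfolding transition_matrix_def pverts_cayley
proof (rule mat_exp_on_automorphism[OF bij _ xy])
  fix x y assume xy: "x \<in> carrier G" "y \<in> carrier G"
  then have "\<pi> x \<in> carrier G" "\<pi> y \<in> carrier G" using bij by (auto simp: bij_betw_def)
  with xy aut show "\<i> * complex_of_real t * adj (\<pi> x) (\<pi> y) = \<i> * complex_of_real t * adj x y"
    by (simp add: adj_eq)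
qed

lemma transition_right_translate:
  assumes g: "g \<in> carrier G" and xy: "x \<in> carrier G" "y \<in> carrier G"
  shows "H t (x \<otimes> g) (y \<otimes> g) = H t x y"
proof (rule transition_automorphism[OF _ _ xy])
  show "bij_betw (\<lambda>x. x \<otimes> g) (carrier G) (carrier G)"
    by (rule bij_betw_byWitness[where f' = "\<lambda>x. x \<otimes> inv g"]) (use g in \<open>auto simp: m_assoc\<close>)
  fix x y assume "x \<in> carrier G" "y \<in> carrier G"
  then have "y \<otimes> g \<otimes> inv (x \<otimes> g) = y \<otimes> inv x"
    using g by (simp add: inv_mult_group m_assoc mult_inv_cancel_left)
  then show "y \<otimes> g \<otimes> inv (x \<otimes> g) \<in> S \<longleftrightarrow> y \<otimes> inv x \<in> S" by simp
qed

text \<open>Left translations are automorphisms because the label \<open>y \<otimes> inv x\<close>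
  of a pair is only conjugated by \<open>g\<close>.\<close>

lemma transition_left_translate:
  assumes g: "g \<in> carrier G" and xy: "x \<in> carrier G" "y \<in> carrier G"
  shows "H t (g \<otimes> x) (g \<otimes> y) = H t x y"
proof (rule transition_automorphism[OF _ _ xy])
  show "bij_betw (\<lambda>x. g \<otimes> x) (carrier G) (carrier G)"
    by (rule bij_betw_byWitness[where f' = "\<lambda>x. inv g \<otimes> x"]) (use g in \<open>auto simp flip: m_assoc\<close>)
  fix x y assume xy: "x \<in> carrier G" "y \<in> carrier G"
  then have "g \<otimes> y \<otimes> inv (g \<otimes> x) = g \<otimes> (y \<otimes> inv x) \<otimes> inv g"
    using g by (simp add: inv_mult_group m_assoc)
  then show "g \<otimes> y \<otimes> inv (g \<otimes> x) \<in> S \<longleftrightarrow> y \<otimes> inv x \<in> S" using S_conj_iff g xy by simp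
qed

text \<open>Inversion preserves adjacency, since \<open>inv y \<otimes> x\<close> is conjugate to
  the inverse of \<open>y \<otimes> inv x\<close>.\<close>

lemma transition_inverse:
  assumes xy: "x \<in> carrier G" "y \<in> carrier G"
  shows "H t (inv x) (inv y) = H t x y"
proof (rule transition_automorphism[OF _ _ xy])
  show "bij_betw (\<lambda>x. inv x) (carrier G) (carrier G)"
    by (rule bij_betw_byWitness[where f' = "\<lambda>x. inv x"]) auto
  fix x y assume xy: "x \<in> carrier G" "y \<in> carrier G"
  have "inv (y \<otimes> inv x) = y \<otimes> (inv y \<otimes> x) \<otimes> inv y"
    using xy by (simp add: inv_mult_group flip: m_assoc)
  then show "inv y \<otimes> inv (inv x) \<in> S \<longleftrightarrow> y \<otimes> inv x \<in> S"
    using S_conj_iff[of "inv y \<otimes> x" y] S_inv_iff[of "y \<otimes> inv x"] xy by auto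
qed

lemma transition_from_one:
  assumes xy: "x \<in> carrier G" "y \<in> carrier G"
  shows "H t x y = H t \<one> (y \<otimes> inv x)"
  using transition_right_translate[of "inv x" x y] xy by simp

text \<open>Right translation moves both entries into the row of the identity, where their positions
  are inverse to each other.\<close>

lemma transition_symmetric:
  assumes xy: "x \<in> carrier G" "y \<in> carrier G"
  shows "H t x y = H t y x"
proof -
  have "H t x y = H t \<one> (inv (y \<otimes> inv x))"
    using transition_from_one[OF xy] transition_inverse[of \<one> "y \<otimes> inv x"] xy by simp
  then show ?thesis using transition_from_one[OF xy(2,1)] xy by (simp add: inv_mult_group)
qed

lemma revival_iff:
  assumes uv: "u \<in> carrier G" "v \<in> carrier G" "u \<noteq> v" and \<beta>: "\<beta> \<noteq> 0"
  shows "revival \<Gamma> \<alpha> \<beta> u v t \<longleftrightarrow>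
    (\<forall>x\<in>carrier G. H t x u = \<alpha> * unit_vec_at u x + \<beta> * unit_vec_at v x) \<and> (cmod \<alpha>)\<^sup>2 + (cmod \<beta>)\<^sup>2 = 1"
proof -
  have "mat_vec_on (carrier G) (H t) (unit_vec_at u) x = H t x u" for x
    using fin uv by (simp add: mat_vec_on_def unit_vec_at_def if_distrib[of "\<lambda>c. _ * c"] cong: if_cong)
  then show ?thesis using uv \<beta> by (simp add: revival_def pverts_cayley)
qed

subsection \<open>Revival\<close>

text \<open>The row of the identity in \<open>H t\<close> is supported on \<open>\<one>\<close> and
  \<open>z\<close>. Its support is stable under conjugation and inversion, and
  \<open>z \<noteq> \<one>\<close>, so every conjugate of \<open>z\<close> and the inverse of
  \<open>z\<close> must be \<open>z\<close> itself.\<close>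

lemma revival_central_involution:
  assumes uv: "u \<in> carrier G" "v \<in> carrier G" "u \<noteq> v" and \<beta>: "\<beta> \<noteq> 0"
    and rev: "\<And>x. x \<in> carrier G \<Longrightarrow> H t x u = \<alpha> * unit_vec_at u x + \<beta> * unit_vec_at v x"
  defines "z \<equiv> u \<otimes> inv v"
  shows "z \<in> center G" "z \<otimes> z = \<one>"
proof -
  have z: "z \<in> carrier G" using uv by (simp add: z_def)
  have z1: "z \<noteq> \<one>" using uv by (metis z_def inv_equality inv_inv inv_closed)
  \<comment> \<open>This is the entry at \<open>(v, u)\<close>, which equals
    \<open>\<beta>\<close>.\<close>
  have Hz: "H t \<one> z \<noteq> 0"
    using transition_from_one[OF uv(2,1)] rev[OF uv(2)] uv \<beta> by (simp add: z_def unit_vec_at_def)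
  have supp: "y = \<one> \<or> y = z" if y: "y \<in> carrier G" and nz: "H t \<one> y \<noteq> 0" for y
  proof -
    \<comment> \<open>The vertex for which the entry at \<open>(?x, u)\<close> translates to the
      entry at \<open>(\<one>, y)\<close>.\<close>
    let ?x = "inv y \<otimes> u"
    have x: "?x \<in> carrier G" using y uv by simp
    have "u \<otimes> inv ?x = y" using y uv by (simp add: inv_mult_group mult_inv_cancel_left)
    then have "H t ?x u \<noteq> 0" using transition_from_one[OF x uv(1)] nz by simp
    then have "?x = u \<or> ?x = v" using rev[OF x] by (auto simp: unit_vec_at_def split: if_splits)
    then show ?thesis using \<open>u \<otimes> inv ?x = y\<close> uv by (auto simp: z_def)
  qed
  have "z \<otimes> g = g \<otimes> z" if g: "g \<in> carrier G" for g
  proof -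
    let ?y = "g \<otimes> z \<otimes> inv g"
    have y: "?y \<in> carrier G" using g z by simp
    have "H t \<one> ?y = H t (g \<otimes> \<one>) (g \<otimes> z)"
      using transition_from_one[of g "g \<otimes> z"] g z by simp
    then have "H t \<one> ?y \<noteq> 0"
      using transition_left_translate[OF g one_closed z] Hz by simp
    with supp[OF y] have "?y = \<one> \<or> ?y = z" by blast
    moreover have "?y \<otimes> g = g \<otimes> z" using g z by (simp add: m_assoc)
    ultimately have "g \<otimes> z = g \<or> g \<otimes> z = z \<otimes> g" using g by auto
    moreover have "g \<otimes> z \<noteq> g" using z1 z g by simp
    ultimately show ?thesis by argo
  qed
  with z show "z \<in> center G" unfolding center_def by (intro CollectI conjI ballI)
  have "inv z = \<one> \<or> inv z = z"
    using supp[of "inv z"] transition_inverse[OF one_closed z] Hz z by simp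
  then show "z \<otimes> z = \<one>" using z z1 by (metis inv_eq_1_iff r_inv)
qed

text \<open>A coefficient \<open>\<phi>\<close> with value 1 at \<open>u\<close> is hit by row
  \<open>u\<close> of \<open>H t\<close>. As an eigenfunction it yields the exponential; by revival
  it yields \<open>\<alpha> + \<beta> * \<phi> v\<close>, and \<open>\<phi> v = \<epsilon>\<close>
  because \<open>v\<close> is the translate of \<open>u\<close> by the involution.\<close>

lemma revival_exp_eig:
  assumes uv: "u \<in> carrier G" "v \<in> carrier G"
    and rev: "\<And>x. x \<in> carrier G \<Longrightarrow> H t x u = \<alpha> * unit_vec_at u x + \<beta> * unit_vec_at v x"
    and invol: "(u \<otimes> inv v) \<otimes> (u \<otimes> inv v) = \<one>"
    and irr: "irreducible_rep G n \<rho>" and \<epsilon>: "\<rho> (u \<otimes> inv v) = \<epsilon> \<cdot>\<^sub>m 1\<^sub>m n"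
  shows "exp (\<i> * complex_of_real t * eig n \<rho>) = \<alpha> + \<epsilon> * \<beta>"
proof -
  let ?z = "u \<otimes> inv v"
  have z: "?z \<in> carrier G" using uv by simp
  have "v = inv ?z \<otimes> u" using uv by (simp add: inv_mult_group m_assoc)
  also have "inv ?z = ?z" using invol z by (simp add: inv_equality)
  finally have v: "v = ?z \<otimes> u" .
  obtain c w where cw: "c \<in> carrier_vec n" "w \<in> carrier_vec n" "c \<bullet> (\<rho> u *\<^sub>v w) = 1"
    using normalized_coefficient[OF irr uv(1)] .
  define \<phi> where "\<phi> x = c \<bullet> (\<rho> x *\<^sub>v w)" for x
  have "\<phi> v = \<epsilon>"
    unfolding \<phi>_def by (subst v) (simp add: central_scalar_coefficient[OF irr z \<epsilon> cw(1,2) uv(1)] cw(3))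
  have "exp (\<i> * complex_of_real t * eig n \<rho>) * \<phi> u = (\<Sum>y\<in>carrier G. H t u y * \<phi> y)"
    using transition_eigenfunction[of \<phi> "eig n \<rho>" u t] coefficient_eigenfunction[OF irr cw(1,2)] uv
    unfolding \<phi>_def by simp
  also have "\<dots> = (\<Sum>y\<in>carrier G. \<alpha> * (unit_vec_at u y * \<phi> y) + \<beta> * (unit_vec_at v y * \<phi> y))"
    using transition_symmetric[OF uv(1)] rev by (intro sum.cong) (auto simp: algebra_simps)
  also have "\<dots> = \<alpha> * \<phi> u + \<beta> * \<phi> v"
    using fin uv by (simp add: sum.distrib unit_vec_at_def if_distrib[of "\<lambda>c. c * _"] flip: sum_distrib_left cong: if_cong)
  finally show ?thesis using cw(3) \<open>\<phi> v = \<epsilon>\<close> by (simp add: \<phi>_def mult.commute)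
qed

text \<open>Both sides, as functions of \<open>x\<close>, pair with a conjugated coefficient to
  \<open>\<alpha> + \<epsilon> * \<beta>\<close> times its value at \<open>u\<close>, so their
  difference vanishes by completeness.\<close>

lemma exp_eig_imp_transition:
  assumes uv: "u \<in> carrier G" "v \<in> carrier G"
    and z: "u \<otimes> inv v \<in> center G" "(u \<otimes> inv v) \<otimes> (u \<otimes> inv v) = \<one>"
    and ex: "\<And>n \<rho> \<epsilon>. irreducible_rep G n \<rho> \<Longrightarrow> \<epsilon> = 1 \<or> \<epsilon> = - 1 \<Longrightarrow> \<rho> (u \<otimes> inv v) = \<epsilon> \<cdot>\<^sub>m 1\<^sub>m n \<Longrightarrow>
      exp (\<i> * complex_of_real t * eig n \<rho>) = \<alpha> + \<epsilon> * \<beta>"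
    and x: "x \<in> carrier G"
  shows "H t x u = \<alpha> * unit_vec_at u x + \<beta> * unit_vec_at v x"
proof -
  let ?z = "u \<otimes> inv v"
  have zG: "?z \<in> carrier G" using uv by simp
  have "v = inv ?z \<otimes> u" using uv by (simp add: inv_mult_group m_assoc)
  also have "inv ?z = ?z" using z(2) zG by (simp add: inv_equality)
  finally have v: "v = ?z \<otimes> u" .
  define f where "f x = H t x u - (\<alpha> * unit_vec_at u x + \<beta> * unit_vec_at v x)" for x
  have "f x = 0"
  proof (rule coefficients_complete[OF fin _ x])
    fix n \<rho> and c w :: "complex vec" assume irr: "irreducible_rep G n \<rho>" and cw: "c \<in> carrier_vec n" "w \<in> carrier_vec n"
    obtain \<epsilon> where \<epsilon>: "\<epsilon> = 1 \<or> \<epsilon> = - 1" "\<rho> ?z = \<epsilon> \<cdot>\<^sub>m 1\<^sub>m n"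
      using central_involution_acts_by_sign[OF irr z] by blast
    \<comment> \<open>Completeness tests against conjugates. Since the eigenvalue and the sign are
      real, \<open>\<psi>\<close> has the same eigenvalue and the same sign as the
      coefficient.\<close>
    define \<psi> where "\<psi> x = cnj (c \<bullet> (\<rho> x *\<^sub>v w))" for x
    have "\<psi> v = \<epsilon> * \<psi> u"
      unfolding \<psi>_def using \<epsilon>(1)
      by (subst v) (auto simp: central_scalar_coefficient[OF irr zG \<epsilon>(2) cw uv(1)])
    have "nbsum \<psi> x = eig n \<rho> * \<psi> x" if "x \<in> carrier G" for x
    proof -
      have "nbsum \<psi> x = cnj (nbsum (\<lambda>x. c \<bullet> (\<rho> x *\<^sub>v w)) x)" by (simp add: nbsum_def \<psi>_def)
      then show ?thesis
        using coefficient_eigenfunction[OF irr cw that] eig_real[OF irr] by (simp add: \<psi>_def)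
    qed
    then have "(\<Sum>x\<in>carrier G. H t u x * \<psi> x) = exp (\<i> * complex_of_real t * eig n \<rho>) * \<psi> u"
      by (rule transition_eigenfunction[OF _ uv(1)])
    also have "(\<Sum>x\<in>carrier G. H t u x * \<psi> x) = (\<Sum>x\<in>carrier G. H t x u * \<psi> x)"
      using transition_symmetric[OF uv(1)] by (intro sum.cong) auto
    also have "exp (\<i> * complex_of_real t * eig n \<rho>) = \<alpha> + \<epsilon> * \<beta>" by (rule ex[OF irr \<epsilon>])
    finally have 1: "(\<Sum>x\<in>carrier G. H t x u * \<psi> x) = (\<alpha> + \<epsilon> * \<beta>) * \<psi> u" .
    have "(\<Sum>x\<in>carrier G. f x * \<psi> x)
        = (\<Sum>x\<in>carrier G. H t x u * \<psi> x - (\<alpha> * (unit_vec_at u x * \<psi> x) + \<beta> * (unit_vec_at v x * \<psi> x)))"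
      by (simp add: f_def algebra_simps)
    also have "\<dots> = (\<alpha> + \<epsilon> * \<beta>) * \<psi> u - (\<alpha> * \<psi> u + \<beta> * \<psi> v)"
      using fin uv by (simp add: sum_subtractf sum.distrib 1 unit_vec_at_def if_distrib[of "\<lambda>c. c * _"] flip: sum_distrib_left cong: if_cong)
    also have "\<dots> = 0" by (simp add: \<open>\<psi> v = \<epsilon> * \<psi> u\<close> algebra_simps)
    finally show "(\<Sum>x\<in>carrier G. f x * cnj (c \<bullet> (\<rho> x *\<^sub>v w))) = 0" by (simp add: \<psi>_def)
  qed
  then show ?thesis by (simp add: f_def)
qed

section \<open>Traces on the sign eigenspaces and integrality\<close>

text \<open>The constant function 1 is a joint eigenfunction with these values.\<close>

lemma trivial_eigenvalue:
  assumes z: "z \<in> center G"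
  obtains n \<rho> where "irreducible_rep G n \<rho>" "eig n \<rho> = of_nat (card S)" "\<rho> z = 1 \<cdot>\<^sub>m 1\<^sub>m n"
  using joint_eigenfunction_irreducible[OF z, of "\<lambda>_. 1" "of_nat (card S)" 1 \<one>]
  by (auto simp: nbsum_def)

text \<open>If only the sign 1 occurred, \<open>z\<close> would act trivially in every irreducible
  representation and hence be the identity.\<close>

lemma exists_odd_irreducible:
  assumes z: "z \<in> center G" "z \<otimes> z = \<one>" "z \<noteq> \<one>"
  obtains n \<rho> where "irreducible_rep G n \<rho>" "\<rho> z = (- 1) \<cdot>\<^sub>m 1\<^sub>m n"
proof -
  have zG: "z \<in> carrier G" using z(1) by (simp add: center_def)
  have "1 \<cdot>\<^sub>m 1\<^sub>m n = (1\<^sub>m n :: complex mat)" for n by (auto intro!: eq_matI)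
  then show ?thesis
    using irreducibles_faithful[OF fin zG] central_involution_acts_by_sign[OF _ z(1,2)] z(3) that by metis
qed

text \<open>The traced operator is \<open>(A - \<mu>) (1 + \<epsilon> Z)\<close> with \<open>Z\<close> the translation by \<open>z\<close>: it vanishes where
  \<open>Z = - \<epsilon>\<close>, and equals \<open>2 (A - \<mu>)\<close> where \<open>Z = \<epsilon>\<close>.\<close>

lemma signed_trace_mem:
  assumes z: "z \<in> center G" "z \<otimes> z = \<one>" "z \<noteq> \<one>" and \<epsilon>: "\<epsilon> = 1 \<or> \<epsilon> = - 1" and S1: "\<one> \<notin> S"
    and L: "0 \<in> L" "\<And>a b. a \<in> L \<Longrightarrow> b \<in> L \<Longrightarrow> a + b \<in> L"
    and mem: "\<And>n \<rho>. irreducible_rep G n \<rho> \<Longrightarrow> \<rho> z = \<epsilon> \<cdot>\<^sub>m 1\<^sub>m n \<Longrightarrow> 2 * (eig n \<rho> - \<mu>) \<in> L"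
  shows "of_nat (card (carrier G)) * ((if z \<in> S then \<epsilon> else 0) - \<mu>) \<in> L"
proof -
  have zG: "z \<in> carrier G" and zc: "\<And>g. g \<in> carrier G \<Longrightarrow> z \<otimes> g = g \<otimes> z"
    using z(1) by (auto simp: center_def)
  have \<epsilon>\<epsilon>: "\<epsilon> * \<epsilon> = 1" using \<epsilon> by auto
  have zz: "z \<otimes> (z \<otimes> x) = x" if "x \<in> carrier G" for x
    using that zG z(2) by (simp flip: m_assoc)
  have SG: "s \<in> carrier G" if "s \<in> S" for s using that S_sub by auto
  define A where "A x y = (if y \<otimes> inv x \<in> S then 1 else 0 :: complex)" for x y
  define D where "D x y = (if y = x then 1 else 0 :: complex)" for x y :: 'a
  define M where "M x y = A x y + \<epsilon> * A (z \<otimes> x) y - \<mu> * (D x y + \<epsilon> * D (z \<otimes> x) y)" for x y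
  have M_apply: "mat_vec_on (carrier G) M f x
      = nbsum f x + \<epsilon> * nbsum f (z \<otimes> x) - \<mu> * (f x + \<epsilon> * f (z \<otimes> x))" if x: "x \<in> carrier G" for f x
  proof -
    have D: "(\<Sum>y\<in>carrier G. D x y * f y) = f x" if "x \<in> carrier G" for x
      using fin that by (simp add: D_def if_distrib[of "\<lambda>c. c * _"] cong: if_cong)
    have A: "(\<Sum>y\<in>carrier G. A x y * f y) = nbsum f x" if "x \<in> carrier G" for x
      using sum_left_translates[OF that, of f] by (simp add: A_def)
    have "mat_vec_on (carrier G) M f x = (\<Sum>y\<in>carrier G. A x y * f y) + \<epsilon> * (\<Sum>y\<in>carrier G. A (z \<otimes> x) y * f y)
      - \<mu> * ((\<Sum>y\<in>carrier G. D x y * f y) + \<epsilon> * (\<Sum>y\<in>carrier G. D (z \<otimes> x) y * f y))"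
      by (simp add: mat_vec_on_def M_def algebra_simps sum.distrib sum_subtractf sum_distrib_left)
    then show ?thesis using D A x zG by simp
  qed
  have "(\<Sum>x\<in>carrier G. M x x) \<in> L"
  proof (rule trace_on_mem_additive[where M = M, OF fin _ L])
    fix k f assume ev: "eigenfunction_on (carrier G) M f k"
    show "k \<in> L"
    proof (cases "k = 0")
      case False
      have Mf: "nbsum f x + \<epsilon> * nbsum f (z \<otimes> x) - \<mu> * (f x + \<epsilon> * f (z \<otimes> x)) = k * f x"
        if "x \<in> carrier G" for x
        using ev M_apply[OF that, of f] that by (simp add: eigenfunction_on_def)
      \<comment> \<open>Replacing \<open>x\<close> by \<open>z \<otimes> x\<close> multiplies the
        left side of \<open>Mf\<close> by \<open>\<epsilon>\<close>; a nonzero \<open>k\<close>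
        passes this sign on to \<open>f\<close>.\<close>
      have zf: "f (z \<otimes> x) = \<epsilon> * f x" if x: "x \<in> carrier G" for x
      proof -
        have "k * f (z \<otimes> x) = \<epsilon> * (k * f x)"
          unfolding Mf[OF x, symmetric] Mf[OF m_closed[OF zG x], symmetric] zz[OF x]
          using \<epsilon> by (auto simp: algebra_simps)
        then show ?thesis using False by simp
      qed
      have znb: "nbsum f (z \<otimes> x) = \<epsilon> * nbsum f x" if x: "x \<in> carrier G" for x
      proof -
        have "nbsum f (z \<otimes> x) = (\<Sum>s\<in>S. f (z \<otimes> (s \<otimes> x)))"
          unfolding nbsum_def
        proof (rule sum.cong[OF refl])
          fix s assume "s \<in> S"
          then have "s \<otimes> (z \<otimes> x) = z \<otimes> (s \<otimes> x)"
            using SG x zG zc[of s] by (simp flip: m_assoc)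
          then show "f (s \<otimes> (z \<otimes> x)) = f (z \<otimes> (s \<otimes> x))" by simp
        qed
        also have "\<dots> = (\<Sum>s\<in>S. \<epsilon> * f (s \<otimes> x))"
          using zf SG x by (intro sum.cong) auto
        finally show ?thesis by (simp add: nbsum_def sum_distrib_left)
      qed
      have nb: "nbsum f x = (\<mu> + k / 2) * f x" if x: "x \<in> carrier G" for x
      proof -
        have "nbsum f x + nbsum f x - \<mu> * (f x + f x) = k * f x"
          using Mf[OF x] unfolding znb[OF x] zf[OF x] mult.assoc[symmetric] \<epsilon>\<epsilon> by simp
        then show ?thesis by (simp add: field_simps)
      qed
      obtain x0 where x0: "x0 \<in> carrier G" "f x0 \<noteq> 0" using ev by (auto simp: eigenfunction_on_def)
      \<comment> \<open>For this representation the value \<open>2 * (eig n \<rho> - \<mu>)\<close>,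
        which lies in \<open>L\<close>, is exactly \<open>k\<close>.\<close>
      obtain n \<rho> where "irreducible_rep G n \<rho>" "eig n \<rho> = \<mu> + k / 2" "\<rho> z = \<epsilon> \<cdot>\<^sub>m 1\<^sub>m n"
        using joint_eigenfunction_irreducible[OF z(1) nb zf x0] .
      then show ?thesis using mem[of n \<rho>] by simp
    qed (use L in simp)
  qed
  \<comment> \<open>The terms \<open>A x x\<close> and \<open>D (z \<otimes> x) x\<close> vanish,
    because \<open>\<one> \<notin> S\<close> and translation by \<open>z\<close> fixes no
    vertex.\<close>
  also have "(\<Sum>x\<in>carrier G. M x x) = (\<Sum>x\<in>carrier G. (if z \<in> S then \<epsilon> else 0) - \<mu>)"
  proof (rule sum.cong[OF refl])
    fix x assume x: "x \<in> carrier G"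
    have "x \<otimes> inv (z \<otimes> x) = inv z" using x zG by (simp add: inv_mult_group mult_inv_cancel_left)
    also have "inv z = z" using z(2) zG by (simp add: inv_equality)
    finally have "A (z \<otimes> x) x = (if z \<in> S then 1 else 0)" by (simp add: A_def)
    moreover have "A x x = 0" using x S1 by (simp add: A_def)
    moreover have "x \<noteq> z \<otimes> x" using x zG z(3) by simp
    ultimately show "M x x = (if z \<in> S then \<epsilon> else 0) - \<mu>"
      unfolding M_def D_def by simp
  qed
  finally show ?thesis by simp
qed

text \<open>Real \<open>a\<close> and \<open>b\<close> with equal exponentials differ by a multiple
  of \<open>2 * pi / t\<close>. The doubling matches the assumption \<open>mem\<close> of
  \<open>signed_trace_mem\<close>.\<close>

lemma exp_eq_imp_lattice:
  assumes t: "t \<noteq> 0" and real: "cnj a = a" "cnj b = b"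
    and eq: "exp (\<i> * complex_of_real t * a) = exp (\<i> * complex_of_real t * b)"
  shows "\<exists>k::int. 2 * (a - b) = of_int k * complex_of_real (4 * pi / t)"
proof -
  define d where "d = Re a - Re b"
  have d: "a - b = complex_of_real d" using real by (simp add: d_def complex_eq_iff)
  have "cis (t * d) = exp (\<i> * complex_of_real t * (a - b))"
    unfolding d by (simp add: cis_conv_exp mult.assoc)
  also have "\<dots> = 1" using eq by (simp add: right_diff_distrib exp_diff)
  finally have "cos (t * d) = 1" by (simp add: complex_eq_iff)
  then obtain k :: int where k: "t * d = of_int k * 2 * pi" using cos_one_2pi_int[of "t * d"] by auto
  then have "2 * d = of_int k * (4 * pi / t)" using t by (simp add: field_simps)
  then have "complex_of_real (2 * d) = complex_of_real (of_int k * (4 * pi / t))" by (rule arg_cong)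
  then show ?thesis unfolding d by (intro exI[of _ k]) (simp only: of_real_mult of_real_of_int_eq of_real_numeral)
qed

text \<open>\<open>signed_trace_mem\<close> is applied with \<open>L\<close> the integer multiples
  of \<open>b = 4 * pi / t\<close>. The eigenvalue \<open>card S\<close> makes \<open>b\<close>
  rational outside a degenerate case, and then each eigenvalue is a rational algebraic
  integer.\<close>

lemma eig_integral:
  assumes z: "z \<in> center G" "z \<otimes> z = \<one>" "z \<noteq> \<one>" and S1: "\<one> \<notin> S" and t: "t \<noteq> 0"
    and same: "\<And>n \<rho> n' \<rho>' \<epsilon>. irreducible_rep G n \<rho> \<Longrightarrow> irreducible_rep G n' \<rho>' \<Longrightarrow>
      \<rho> z = \<epsilon> \<cdot>\<^sub>m 1\<^sub>m n \<Longrightarrow> \<rho>' z = \<epsilon> \<cdot>\<^sub>m 1\<^sub>m n' \<Longrightarrow> \<epsilon> = 1 \<or> \<epsilon> = - 1 \<Longrightarrow>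
      exp (\<i> * complex_of_real t * eig n \<rho>) = exp (\<i> * complex_of_real t * eig n' \<rho>')"
    and irr: "irreducible_rep G n \<rho>"
  shows "eig n \<rho> \<in> \<int>"
proof -
  have zG: "z \<in> carrier G" using z(1) by (simp add: center_def)
  let ?N = "of_nat (card (carrier G)) :: complex"
  define b where "b = complex_of_real (4 * pi / t)"
  have N: "?N \<noteq> 0" using fin by (auto simp: card_eq_0_iff)
  have trace: "\<exists>k::int. ?N * ((if z \<in> S then \<epsilon> else 0) - eig m \<tau>) = of_int k * b"
    if "irreducible_rep G m \<tau>" "\<tau> z = \<epsilon> \<cdot>\<^sub>m 1\<^sub>m m" "\<epsilon> = 1 \<or> \<epsilon> = - 1" for m \<tau> \<epsilon>
  proof -
    have "?N * ((if z \<in> S then \<epsilon> else 0) - eig m \<tau>) \<in> {of_int k * b | k::int. True}"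
    proof (rule signed_trace_mem[OF z that(3) S1])
      show "0 \<in> {of_int k * b | k::int. True}" by (auto intro!: exI[of _ 0])
      show "x + y \<in> {of_int k * b | k::int. True}"
        if "x \<in> {of_int k * b | k::int. True}" "y \<in> {of_int k * b | k::int. True}" for x y
        using that by (auto simp: distrib_right[symmetric] of_int_add[symmetric] simp del: of_int_add)
      show "2 * (eig n \<rho> - eig m \<tau>) \<in> {of_int k * b | k::int. True}"
        if "irreducible_rep G n \<rho>" "\<rho> z = \<epsilon> \<cdot>\<^sub>m 1\<^sub>m n" for n \<rho>
        using exp_eq_imp_lattice[OF t eig_real[OF that(1)] eig_real[OF \<open>irreducible_rep G m \<tau>\<close>] same[OF that(1) \<open>irreducible_rep G m \<tau>\<close> that(2)
            \<open>\<tau> z = \<epsilon> \<cdot>\<^sub>m 1\<^sub>m m\<close> \<open>\<epsilon> = 1 \<or> \<epsilon> = - 1\<close>]] by (auto simp: b_def)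
    qed
    then show ?thesis by blast
  qed
  obtain \<epsilon> where \<epsilon>: "\<rho> z = \<epsilon> \<cdot>\<^sub>m 1\<^sub>m n" "\<epsilon> = 1 \<or> \<epsilon> = - 1"
    using central_involution_acts_by_sign[OF irr z(1,2)] by blast
  have int: "\<epsilon> \<in> \<int>" using \<epsilon>(2) by auto
  show ?thesis
  \<comment> \<open>The trace belonging to the eigenvalue \<open>card S\<close> vanishes exactly in
    the first case and then says nothing about \<open>b\<close>; the eigenvalues are computed
    directly there.\<close>
  proof (cases "card S = (if z \<in> S then 1 else 0)")
    case True
    then have "S = {} \<or> S = {z}" using finite_S by (auto simp: card_1_singleton_iff split: if_splits)
    then show ?thesis
    proof (elim disjE)
      assume "S = {z}"
      moreover have "rep_character G n \<rho> z = \<epsilon> * of_nat n"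
        using character_eq_sign_degree_iff[OF fin irr zG \<epsilon>(2)] \<epsilon>(1) by (simp add: char_degree_rep[OF irr])
      ultimately have "eig n \<rho> = \<epsilon>"
        unfolding eig_def cayley_eigenvalue_def char_degree_rep[OF irr]
        using irreducible_repD(2)[OF irr] by simp
      then show ?thesis using int by simp
    next
      assume "S = {}"
      then show ?thesis unfolding eig_def cayley_eigenvalue_def by simp
    qed
  next
    case False
    obtain m \<tau> where \<tau>: "irreducible_rep G m \<tau>" "eig m \<tau> = of_nat (card S)" "\<tau> z = 1 \<cdot>\<^sub>m 1\<^sub>m m"
      using trivial_eigenvalue[OF z(1)] .
    obtain k :: int where k: "?N * ((if z \<in> S then 1 else 0) - of_nat (card S)) = of_int k * b"
      using trace[OF \<tau>(1,3)] \<tau>(2) by auto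
    have "(if z \<in> S then 1 else 0) - of_nat (card S) \<noteq> (0 :: complex)" using False by auto
    with k N have "k \<noteq> 0" by auto
    then have "b = ?N * ((if z \<in> S then 1 else 0) - of_nat (card S)) / of_int k"
      using k by (simp add: field_simps)
    also have "\<dots> \<in> \<rat>" by auto
    finally have b: "b \<in> \<rat>" .
    obtain k' :: int where k': "?N * ((if z \<in> S then \<epsilon> else 0) - eig n \<rho>) = of_int k' * b"
      using trace[OF irr \<epsilon>] by blast
    then have "eig n \<rho> = (if z \<in> S then \<epsilon> else 0) - of_int k' * b / ?N"
      using N by (simp add: field_simps)
    also have "\<dots> \<in> \<rat>" using b \<epsilon>(2) by auto
    finally show ?thesis
      using rational_algebraic_int_is_int[OF eig_algebraic_int[OF irr]] by blast
  qed
qed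

section \<open>Revival in terms of irreducible representations\<close>

lemma revival_characterization:
  assumes \<beta>: "\<beta> \<noteq> 0" and uv: "u \<in> carrier G" "v \<in> carrier G" "u \<noteq> v"
  defines "z \<equiv> u \<otimes> inv v"
  shows "revival \<Gamma> \<alpha> \<beta> u v t \<longleftrightarrow> z \<in> center G \<and> z \<otimes> z = \<one> \<and>
    (\<forall>n \<rho>. irreducible_rep G n \<rho> \<longrightarrow> \<rho> z = 1 \<cdot>\<^sub>m 1\<^sub>m n \<longrightarrow> exp (\<i> * complex_of_real t * eig n \<rho>) = \<alpha> + \<beta>) \<and>
    (\<forall>n \<rho>. irreducible_rep G n \<rho> \<longrightarrow> \<rho> z = (- 1) \<cdot>\<^sub>m 1\<^sub>m n \<longrightarrow> exp (\<i> * complex_of_real t * eig n \<rho>) = \<alpha> - \<beta>)"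
    (is "_ \<longleftrightarrow> _ \<and> _ \<and> ?even \<and> ?odd")
proof
  assume "revival \<Gamma> \<alpha> \<beta> u v t"
  then have rev: "\<And>x. x \<in> carrier G \<Longrightarrow> H t x u = \<alpha> * unit_vec_at u x + \<beta> * unit_vec_at v x"
    by (simp add: revival_iff[OF uv \<beta>])
  have z: "z \<in> center G" "z \<otimes> z = \<one>"
    using revival_central_involution[OF uv \<beta> rev] unfolding z_def by blast+
  with revival_exp_eig[OF uv(1,2) rev, of _ _ 1] revival_exp_eig[OF uv(1,2) rev, of _ _ "- 1"]
  show "z \<in> center G \<and> z \<otimes> z = \<one> \<and> ?even \<and> ?odd" by (simp add: z_def)
next
  assume "z \<in> center G \<and> z \<otimes> z = \<one> \<and> ?even \<and> ?odd"
  then have z: "z \<in> center G" "z \<otimes> z = \<one>" and even: ?even and odd: ?odd by blast+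
  have z1: "z \<noteq> \<one>" using uv by (metis z_def inv_equality inv_inv inv_closed)
  have "H t x u = \<alpha> * unit_vec_at u x + \<beta> * unit_vec_at v x" if "x \<in> carrier G" for x
  proof (rule exp_eig_imp_transition[OF uv(1,2) z[unfolded z_def] _ that])
    fix n \<rho> \<epsilon> assume "irreducible_rep G n \<rho>" "\<epsilon> = 1 \<or> \<epsilon> = - 1" "\<rho> (u \<otimes> inv v) = \<epsilon> \<cdot>\<^sub>m 1\<^sub>m n"
    then show "exp (\<i> * complex_of_real t * eig n \<rho>) = \<alpha> + \<epsilon> * \<beta>"
      using even odd unfolding z_def by (elim disjE) simp_all
  qed
  \<comment> \<open>Both signs occur and the eigenvalues are real, so
    \<open>\<alpha> + \<beta>\<close> and \<open>\<alpha> - \<beta>\<close> have modulus 1; the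
    parallelogram law gives the normalization.\<close>
  moreover have "(cmod \<alpha>)\<^sup>2 + (cmod \<beta>)\<^sup>2 = 1"
  proof -
    have unit: "cmod (exp (\<i> * complex_of_real t * eig n \<rho>)) = 1" if "irreducible_rep G n \<rho>" for n \<rho>
      using eig_real[OF that] by (simp add: complex_eq_iff)
    obtain n \<rho> where "irreducible_rep G n \<rho>" "\<rho> z = 1 \<cdot>\<^sub>m 1\<^sub>m n" using trivial_eigenvalue[OF z(1)] by metis
    with even unit have 1: "cmod (\<alpha> + \<beta>) = 1" by metis
    obtain n \<rho> where "irreducible_rep G n \<rho>" "\<rho> z = (- 1) \<cdot>\<^sub>m 1\<^sub>m n" using exists_odd_irreducible[OF z z1] .
    with odd unit have 2: "cmod (\<alpha> - \<beta>) = 1" by metis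
    have "(cmod (\<alpha> + \<beta>))\<^sup>2 + (cmod (\<alpha> - \<beta>))\<^sup>2 = 2 * ((cmod \<alpha>)\<^sup>2 + (cmod \<beta>)\<^sup>2)"
      unfolding cmod_power2 by (simp add: power2_eq_square algebra_simps)
    with 1 2 show ?thesis by simp
  qed
  ultimately show "revival \<Gamma> \<alpha> \<beta> u v t" by (simp add: revival_iff[OF uv \<beta>])
qed

lemma revival_imp_eig_integral:
  assumes S1: "\<one> \<notin> S" and \<beta>: "\<beta> \<noteq> 0" and uv: "u \<in> carrier G" "v \<in> carrier G" "u \<noteq> v"
    and rev: "revival \<Gamma> \<alpha> \<beta> u v t" and irr: "irreducible_rep G n \<rho>"
  shows "eig n \<rho> \<in> \<int>"
proof -
  let ?z = "u \<otimes> inv v"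
  note char = rev[unfolded revival_characterization[OF \<beta> uv]]
  then have z: "?z \<in> center G" "?z \<otimes> ?z = \<one>" by blast+
  have z1: "?z \<noteq> \<one>" using uv by (metis inv_equality inv_inv inv_closed)
  \<comment> \<open>At time 0 all exponentials are 1. As both signs occur,
    \<open>\<alpha> + \<beta>\<close> and \<open>\<alpha> - \<beta>\<close> would agree, forcing
    \<open>\<beta> = 0\<close>.\<close>
  have "t \<noteq> 0"
  proof
    assume "t = 0"
    obtain m \<tau> where "irreducible_rep G m \<tau>" "\<tau> ?z = 1 \<cdot>\<^sub>m 1\<^sub>m m" using trivial_eigenvalue[OF z(1)] by metis
    then have 1: "\<alpha> + \<beta> = 1" using char \<open>t = 0\<close> by force
    obtain m \<tau> where "irreducible_rep G m \<tau>" "\<tau> ?z = (- 1) \<cdot>\<^sub>m 1\<^sub>m m"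
      using exists_odd_irreducible[OF z z1] .
    then have 2: "\<alpha> - \<beta> = 1" using char \<open>t = 0\<close> by force
    have "2 * \<beta> = (\<alpha> + \<beta>) - (\<alpha> - \<beta>)" by simp
    also have "\<dots> = 0" unfolding 1 2 by simp
    finally show False using \<beta> by simp
  qed
  show ?thesis
  proof (rule eig_integral[OF z z1 S1 \<open>t \<noteq> 0\<close> _ irr])
    fix n \<rho> n' \<rho>' \<epsilon>
    assume "irreducible_rep G n \<rho>" "irreducible_rep G n' \<rho>'" "\<rho> ?z = \<epsilon> \<cdot>\<^sub>m 1\<^sub>m n" "\<rho>' ?z = \<epsilon> \<cdot>\<^sub>m 1\<^sub>m n'"
      "\<epsilon> = 1 \<or> \<epsilon> = - 1"
    then show "exp (\<i> * complex_of_real t * eig n \<rho>) = exp (\<i> * complex_of_real t * eig n' \<rho>')"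
      using char by (elim disjE) simp_all
  qed
qed

end

section \<open>From representations to characters\<close>

theorem theorem1:
  fixes G :: "('a, 'b) monoid_scheme"
    and S :: "'a set"
    and \<alpha> \<beta> :: complex
    and u v :: 'a
    and t :: real
  assumes "group G"
    and "finite (carrier G)"
    and "S \<subseteq> carrier G"
    and "\<forall>s \<in> S. inv\<^bsub>G\<^esub> s \<in> S"
    and "\<one>\<^bsub>G\<^esub> \<notin> S"
    and "union_of_conjugacy_classes G S"
    and "Digraph_Component.connected (with_proj (cayley_graph G S))"
    and "\<alpha> \<noteq> 0" and "\<beta> \<noteq> 0"
    and "u \<in> carrier G" and "v \<in> carrier G" and "u \<noteq> v"
  shows
    "(revival (cayley_graph G S) \<alpha> \<beta> u v t \<longleftrightarrow>
        (\<forall>\<chi> \<in> irr_characters G.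
            \<chi> (u \<otimes>\<^bsub>G\<^esub> inv\<^bsub>G\<^esub> v) = char_degree G \<chi> \<or> \<chi> (u \<otimes>\<^bsub>G\<^esub> inv\<^bsub>G\<^esub> v) = - char_degree G \<chi>) \<and>
        ((\<forall>\<chi> \<in> {\<chi> \<in> irr_characters G. \<chi> (u \<otimes>\<^bsub>G\<^esub> inv\<^bsub>G\<^esub> v) = char_degree G \<chi>}.
            exp (\<i> * complex_of_real t * cayley_eigenvalue G S \<chi>) = \<alpha> + \<beta>) \<and>
         (\<forall>\<chi> \<in> {\<chi> \<in> irr_characters G. \<chi> (u \<otimes>\<^bsub>G\<^esub> inv\<^bsub>G\<^esub> v) = - char_degree G \<chi>}.
            exp (\<i> * complex_of_real t * cayley_eigenvalue G S \<chi>) = \<alpha> - \<beta>))) \<and>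
     ((\<forall>\<chi> \<in> irr_characters G.
          \<chi> (u \<otimes>\<^bsub>G\<^esub> inv\<^bsub>G\<^esub> v) = char_degree G \<chi> \<or> \<chi> (u \<otimes>\<^bsub>G\<^esub> inv\<^bsub>G\<^esub> v) = - char_degree G \<chi>)
        \<longleftrightarrow> even (Coset.order G) \<and> group.ord G (u \<otimes>\<^bsub>G\<^esub> inv\<^bsub>G\<^esub> v) = 2 \<and>
            u \<otimes>\<^bsub>G\<^esub> inv\<^bsub>G\<^esub> v \<in> center G) \<and>
     (revival (cayley_graph G S) \<alpha> \<beta> u v t \<longrightarrow>
        integral_graph (cayley_graph G S) \<and>
        (\<forall>\<chi> \<in> irr_characters G. cayley_eigenvalue G S \<chi> \<in> \<int>))"
proof -
  interpret group G by fact
  interpret quasi_abelian_cayley G S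
    by unfold_locales (use assms(2-4) conjugacy_classes_closed[OF assms(6)] in auto)
  define z where "z = u \<otimes>\<^bsub>G\<^esub> inv\<^bsub>G\<^esub> v"
  have z: "z \<in> carrier G" using assms by (simp add: z_def)
  have z1: "z \<noteq> \<one>\<^bsub>G\<^esub>" using assms(10-12) by (metis z_def inv_equality inv_inv inv_closed)
  note char = revival_characterization[OF assms(9,10-12), of \<alpha> t, folded z_def]
  note signs = all_signs_iff_central_involution[OF assms(2) z z1]
  have even_iff: "rep_character G n \<rho> z = char_degree G (rep_character G n \<rho>) \<longleftrightarrow> \<rho> z = 1 \<cdot>\<^sub>m 1\<^sub>m n"
    if "irreducible_rep G n \<rho>" for n \<rho>
    using character_eq_sign_degree_iff[OF assms(2) that z, of 1] by simp
  have odd_iff: "rep_character G n \<rho> z = - char_degree G (rep_character G n \<rho>) \<longleftrightarrow> \<rho> z = (- 1) \<cdot>\<^sub>m 1\<^sub>m n"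
    if "irreducible_rep G n \<rho>" for n \<rho>
    using character_eq_sign_degree_iff[OF assms(2) that z, of "- 1"] by simp
  have 1: "revival (cayley_graph G S) \<alpha> \<beta> u v t \<longleftrightarrow>
        (\<forall>\<chi> \<in> irr_characters G. \<chi> z = char_degree G \<chi> \<or> \<chi> z = - char_degree G \<chi>) \<and>
        ((\<forall>\<chi> \<in> {\<chi> \<in> irr_characters G. \<chi> z = char_degree G \<chi>}.
            exp (\<i> * complex_of_real t * cayley_eigenvalue G S \<chi>) = \<alpha> + \<beta>) \<and>
         (\<forall>\<chi> \<in> {\<chi> \<in> irr_characters G. \<chi> z = - char_degree G \<chi>}.
            exp (\<i> * complex_of_real t * cayley_eigenvalue G S \<chi>) = \<alpha> - \<beta>))"
  proof -
    \<comment> \<open>Quantifying over characters amounts to quantifying over representations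
      affording them, even when several afford the same character.\<close>
    have all: "(\<forall>\<chi>\<in>{\<chi> \<in> irr_characters G. Q \<chi>}. P \<chi>)
        \<longleftrightarrow> (\<forall>n \<rho>. irreducible_rep G n \<rho> \<longrightarrow> Q (rep_character G n \<rho>) \<longrightarrow> P (rep_character G n \<rho>))" for P Q
      unfolding irr_characters_conv by blast
    show ?thesis
      unfolding char signs all by (simp add: even_iff odd_iff eig_def)
  qed
  \<comment> \<open>The parity of the group order follows from Lagrange's theorem once
    \<open>z\<close> has order two.\<close>
  have 2: "(\<forall>\<chi> \<in> irr_characters G. \<chi> z = char_degree G \<chi> \<or> \<chi> z = - char_degree G \<chi>) \<longleftrightarrow>
      even (Coset.order G) \<and> group.ord G z = 2 \<and> z \<in> center G"
    unfolding signs using ord_eq_2_iff[OF z z1] ord_dvd_group_order[OF z] by auto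
  have 3: "integral_graph (cayley_graph G S) \<and> (\<forall>\<chi> \<in> irr_characters G. cayley_eigenvalue G S \<chi> \<in> \<int>)"
    if rev: "revival (cayley_graph G S) \<alpha> \<beta> u v t"
  proof -
    have int: "eig n \<rho> \<in> \<int>" if "irreducible_rep G n \<rho>" for n \<rho>
      using revival_imp_eig_integral[OF assms(5,9,10-12) rev that] .
    then have "integral_graph (cayley_graph G S)"
      unfolding integral_graph_def using graph_eigenvalue_is_eig by metis
    moreover have "\<forall>\<chi> \<in> irr_characters G. cayley_eigenvalue G S \<chi> \<in> \<int>"
      using int by (auto simp: irr_characters_conv eig_def)
    ultimately show ?thesis ..
  qed
  from 1 2 3 show ?thesis unfolding z_def by blast
qed

end
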